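(* Let $T:L_\infty\rightarrow L_1$ be an operator. (1) If there is $\alpha_0<\beta_0\leq\frac12$ such that $(\alpha_0,\beta_0)\in V(T)$, then $$\{(\alpha,\beta_0):0<\alpha\leq \alpha_0\}\subset V(T).$$ (2) If there is $\frac12\leq\alpha_0<\beta_0$ such that $(\alpha_0,\beta_0)\in V(T)$, then $$\{(\alpha_0,\beta):\beta_0\leq\beta< 1\}\subset V(T).$$
   Context: $L_p$ denotes $L_p(0,1)$ with Lebesgue measure; operators are bounded and linear. An operator between Banach spaces is strictly singular if its restriction to any closed infinite-dimensional subspace is not an isomorphism onto its image. For an operator $T:L_\infty\to L_1$ and $1<p,q<\infty$, $T$ is said to be a bounded (resp. compact, strictly singular) operator $L_p\to L_q$ if it extends from the dense subspace $L_\infty$ of $L_p$ to such an operator. $S(T)$ (resp. $K(T)$) is the set of points $(\frac1p,\frac1q)\in(0,1)\times(0,1)$ such that $T:L_p\to L_q$ is strictly singular (resp. compact), and $V(T)=S(T)\setminus K(T)$. *)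

theory Defs
  imports "HOL-Analysis.Analysis" "HOL-Probability.Essential_Supremum"
begin

abbreviation leb01 :: "real measure" where
  "leb01 \<equiv> lebesgue_on {0<..<1}"

text \<open>Classes of measurable real functions on \<open>(0,1)\<close> modulo equality almost everywhere.
  Every \<open>L\<^sub>p\<close> below is a linear subspace of this one type, so the inclusions between them
  are inclusions of sets.\<close>

quotient_type L0 = "real \<Rightarrow> real" / partial:
  "\<lambda>f g. f \<in> borel_measurable leb01 \<and> g \<in> borel_measurable leb01 \<and> (AE x in leb01. f x = g x)"
proof (rule part_equivpI)
  show "\<exists>f. f \<in> borel_measurable leb01 \<and> f \<in> borel_measurable leb01 \<and>
      (AE x in leb01. (f x :: real) = f x)"
    by (rule exI[of _ "\<lambda>_. 0"]) simp
  show "symp (\<lambda>f g. f \<in> borel_measurable leb01 \<and> g \<in> borel_measurable leb01 \<and>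
      (AE x in leb01. (f x :: real) = g x))"
    by (auto simp: symp_def elim: eventually_mono)
  show "transp (\<lambda>f g. f \<in> borel_measurable leb01 \<and> g \<in> borel_measurable leb01 \<and>
      (AE x in leb01. (f x :: real) = g x))"
    by (auto simp: transp_def elim: eventually_elim2)
qed

instantiation L0 :: real_vector
begin

lift_definition zero_L0 :: L0 is "\<lambda>_. 0" by simp

lift_definition plus_L0 :: "L0 \<Rightarrow> L0 \<Rightarrow> L0" is "\<lambda>f g x. f x + g x"
  by (auto elim: eventually_elim2)

lift_definition minus_L0 :: "L0 \<Rightarrow> L0 \<Rightarrow> L0" is "\<lambda>f g x. f x - g x"
  by (auto elim: eventually_elim2)

lift_definition uminus_L0 :: "L0 \<Rightarrow> L0" is "\<lambda>f x. - f x"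
  by (auto elim: eventually_mono)

lift_definition scaleR_L0 :: "real \<Rightarrow> L0 \<Rightarrow> L0" is "\<lambda>c f x. c * f x"
  by (auto elim: eventually_mono)

instance
  by standard (transfer; auto simp: algebra_simps)+

end

text \<open>A normed space is given by a linear subspace \<open>vecs\<close> of an ambient real vector space,
  together with a norm; the values of \<open>nrm\<close> outside \<open>vecs\<close> play no role.\<close>

record 'v nspace =
  vecs :: "'v set"
  nrm :: "'v \<Rightarrow> real"

definition ntopology :: "'v::real_vector nspace \<Rightarrow> 'v topology" where
  "ntopology X = Metric_space.mtopology (vecs X) (\<lambda>x y. nrm X (x - y))"

definition bounded_operator ::
    "'v::real_vector nspace \<Rightarrow> 'w::real_vector nspace \<Rightarrow> ('v \<Rightarrow> 'w) \<Rightarrow> bool" where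
  "bounded_operator X Y T \<longleftrightarrow>
     T \<in> vecs X \<rightarrow> vecs Y \<and>
     (\<forall>x\<in>vecs X. \<forall>y\<in>vecs X. T (x + y) = T x + T y) \<and>
     (\<forall>c. \<forall>x\<in>vecs X. T (c *\<^sub>R x) = c *\<^sub>R T x) \<and>
     (\<exists>C. \<forall>x\<in>vecs X. nrm Y (T x) \<le> C * nrm X x)"

definition isomorphism ::
    "'v::real_vector nspace \<Rightarrow> 'w::real_vector nspace \<Rightarrow> ('v \<Rightarrow> 'w) \<Rightarrow> bool" where
  "isomorphism X Y T \<longleftrightarrow>
     bounded_operator X Y T \<and> bij_betw T (vecs X) (vecs Y) \<and>
     bounded_operator Y X (inv_into (vecs X) T)"

definition compact_operator ::
    "'v::real_vector nspace \<Rightarrow> 'w::real_vector nspace \<Rightarrow> ('v \<Rightarrow> 'w) \<Rightarrow> bool" where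
  "compact_operator X Y T \<longleftrightarrow>
     bounded_operator X Y T \<and>
     compactin (ntopology Y) (ntopology Y closure_of (T ` {x \<in> vecs X. nrm X x \<le> 1}))"

definition strictly_singular ::
    "'v::real_vector nspace \<Rightarrow> 'w::real_vector nspace \<Rightarrow> ('v \<Rightarrow> 'w) \<Rightarrow> bool" where
  "strictly_singular X Y T \<longleftrightarrow>
     bounded_operator X Y T \<and>
     (\<forall>Z. subspace Z \<and> Z \<subseteq> vecs X \<and> closedin (ntopology X) Z \<and>
          \<not> (\<exists>B. finite B \<and> Z \<subseteq> span B) \<longrightarrow>
        \<not> isomorphism (X\<lparr>vecs := Z\<rparr>) (Y\<lparr>vecs := T ` Z\<rparr>) T)"

lift_definition Lp_norm :: "real \<Rightarrow> L0 \<Rightarrow> real" is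
  "\<lambda>p f. (LINT x|leb01. \<bar>f x\<bar> powr p) powr (1 / p)"
  by (intro arg_cong2[where f = "(powr)"] integral_cong_AE) (auto elim: eventually_mono)

lift_definition Lp_mem :: "real \<Rightarrow> L0 \<Rightarrow> bool" is
  "\<lambda>p f. integrable leb01 (\<lambda>x. \<bar>f x\<bar> powr p)"
  by (intro integrable_cong_AE) (auto elim: eventually_mono)

lift_definition L0_esssup :: "L0 \<Rightarrow> ereal" is
  "\<lambda>f. esssup leb01 (\<lambda>x. ereal \<bar>f x\<bar>)"
  by (intro esssup_AE_cong) (auto elim: eventually_mono)

definition Lp :: "real \<Rightarrow> L0 nspace" where
  "Lp p = \<lparr>vecs = {f. Lp_mem p f}, nrm = Lp_norm p\<rparr>"

definition Linf :: "L0 nspace" where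
  "Linf = \<lparr>vecs = {f. L0_esssup f < \<infinity>}, nrm = (\<lambda>f. real_of_ereal (L0_esssup f))\<rparr>"

definition extends_to_strictly_singular :: "(L0 \<Rightarrow> L0) \<Rightarrow> real \<Rightarrow> real \<Rightarrow> bool" where
  "extends_to_strictly_singular T p q \<longleftrightarrow>
     (\<exists>R. strictly_singular (Lp p) (Lp q) R \<and> (\<forall>f\<in>vecs Linf. R f = T f))"

definition extends_to_compact :: "(L0 \<Rightarrow> L0) \<Rightarrow> real \<Rightarrow> real \<Rightarrow> bool" where
  "extends_to_compact T p q \<longleftrightarrow>
     (\<exists>R. compact_operator (Lp p) (Lp q) R \<and> (\<forall>f\<in>vecs Linf. R f = T f))"

definition S_set :: "(L0 \<Rightarrow> L0) \<Rightarrow> (real \<times> real) set" where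
  "S_set T = {(1 / p, 1 / q) | p q. 1 < p \<and> 1 < q \<and> extends_to_strictly_singular T p q}"

definition K_set :: "(L0 \<Rightarrow> L0) \<Rightarrow> (real \<times> real) set" where
  "K_set T = {(1 / p, 1 / q) | p q. 1 < p \<and> 1 < q \<and> extends_to_compact T p q}"

definition V_set :: "(L0 \<Rightarrow> L0) \<Rightarrow> (real \<times> real) set" where
  "V_set T = S_set T - K_set T"

end

(* Let R : L_p -> L_q be bounded with q < p. Since q < p, the functional
   Phi(u) = |Ru|_q^q - mu |u|_p^p is bounded above for every mu > 0; take a near-maximiser u.

   If q >= 2 and v is supported on a set so small that u carries almost no mass there, then
   |u + v|_p^p and |u - v|_p^p exceed |u|_p^p by at most a constant, whereas by Clarkson's inequality
   |R(u + v)|_q^q or |R(u - v)|_q^q exceeds |Ru|_q^q by |Rv|_q^q. Maximality thus forces Rv to be small: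
   R is uniformly small on unit vectors with small support. Truncation then puts the image of
   the unit ball of L_p within epsilon of the image of a ball of L_inf, so R is compact as soon as some
   L_p' -> L_q extension is.

   If p <= 2, the same perturbation argument (Clarkson in L_p, convexity of |.|^q on the small set) shows that
   the image of the unit ball is equi-integrable in L_q, so total boundedness in a larger space L_q'
   gives total boundedness in L_q.

   Strict singularity passes to smaller domains and larger ranges, since norms that are equivalent on a
   subspace have the same Cauchy sequences. *)
theory Submission
  imports Defs "HOL-Probability.Probability_Measure"
begin

subsection \<open>Inequalities for powers of real numbers\<close>

text \<open>The competitors u + v and u - v are used together because averaging cancels what is odd
  in v; what remains is a gain of order |Rv|_q^q against a cost of order |v|_p^p. Clarkson's
  inequality with constant 1 in front of the gain holds only for exponents at least 2, and its
  reverse only for exponents at most 2; this is the origin of the two regions. For q >= 2 it is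
  spent on the range, so the cost must be controlled by hand, which forces small supports in the
  domain. For p <= 2 it is spent on the domain, and only convexity is left in the range, which
  forces the cut there. Uniformity comes from the order of the choices: mu depends on delta, u on mu
  and delta, and the threshold for the measure on u and delta, before any set or vector is named. A
  second obstacle is that a compact extension is an operator of its own, known to agree with R only
  on L_inf. For the domain change truncation keeps the comparison inside L_inf; for the range change
  density of L_inf identifies the two operators on L_p.\<close>

text \<open>After division by s = a + b both terms lie in [0,1], where x^r <= x.\<close>

lemma powr_superadditive:
  fixes a b r :: real
  assumes "1 \<le> r" "0 \<le> a" "0 \<le> b"
  shows "a powr r + b powr r \<le> (a + b) powr r"
proof (cases "a + b = 0")
  case True
  then show ?thesis using assms by (simp add: add_nonneg_eq_0_iff)
next
  case False
  define s where "s = a + b"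
  have s: "s > 0" using False assms by (simp add: s_def)
  have le: "c powr r \<le> c / s * s powr r" if "0 \<le> c" "c \<le> s" for c
  proof -
    have "c powr r = (c / s) powr r * s powr r"
      using that s by (simp add: powr_mult[symmetric])
    also have "(c / s) powr r \<le> (c / s) powr 1"
      using that s assms by (intro powr_mono') auto
    finally show ?thesis using that s by (simp add: mult_right_mono)
  qed
  have "a powr r + b powr r \<le> (a / s + b / s) * s powr r"
    using le[of a] le[of b] assms by (simp add: s_def distrib_right)
  also have "a / s + b / s = 1" using s by (simp add: s_def add_divide_distrib[symmetric])
  finally show ?thesis by (simp add: s_def)
qed

text \<open>If one of the points is 0 the claim reduces to t^r <= t on [0,1]; convexity on the open
  half-line covers the rest.\<close>

lemma powr_convex_combination:
  fixes a b r t :: real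
  assumes "1 \<le> r" "0 \<le> a" "0 \<le> b" "0 \<le> t" "t \<le> 1"
  shows "(t * a + (1 - t) * b) powr r \<le> t * a powr r + (1 - t) * b powr r"
proof -
  have shrink: "(u * c) powr r \<le> u * c powr r" if "0 \<le> u" "u \<le> 1" "0 \<le> c" for u c :: real
  proof -
    have "u powr r \<le> u powr 1" using that assms(1) by (intro powr_mono') auto
    then show ?thesis using that by (simp add: powr_mult mult_right_mono)
  qed
  consider "a = 0" | "b = 0" | "a > 0" "b > 0" using assms by linarith
  then show ?thesis
  proof cases
    case 1 then show ?thesis using shrink[of "1 - t" b] assms by simp
  next
    case 2 then show ?thesis using shrink[of t a] assms by simp
  next
    case 3
    then show ?thesis
      using convex_onD[OF powr_convex[OF assms(1)], of "1 - t" a b] assms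
      by simp
  qed
qed

lemma powr_midpoint:
  fixes a b r :: real
  assumes "1 \<le> r" "0 \<le> a" "0 \<le> b"
  shows "((a + b) / 2) powr r \<le> (a powr r + b powr r) / 2"
  using powr_convex_combination[of r a b "1/2"] assms by (simp add: add_divide_distrib)

lemma abs_powr_half: "\<bar>x :: real\<bar> powr r = (x\<^sup>2) powr (r / 2)"
proof -
  have "(x\<^sup>2) powr (r / 2) = (\<bar>x\<bar> powr 2) powr (r / 2)"
    by simp
  then show ?thesis by (simp only: powr_powr) simp
qed

text \<open>The parallelogram identity links two estimates for x^(q/2) at squares: superadditivity
  bounds the left side, convexity the right side. Both need q/2 >= 1.\<close>

lemma clarkson_ge2:
  fixes a b q :: real
  assumes "2 \<le> q"
  shows "\<bar>a\<bar> powr q + \<bar>b\<bar> powr q \<le> (\<bar>a + b\<bar> powr q + \<bar>a - b\<bar> powr q) / 2"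
proof -
  have "\<bar>a\<bar> powr q + \<bar>b\<bar> powr q \<le> (a\<^sup>2 + b\<^sup>2) powr (q / 2)"
    unfolding abs_powr_half using assms by (intro powr_superadditive) auto
  also have "a\<^sup>2 + b\<^sup>2 = ((a + b)\<^sup>2 + (a - b)\<^sup>2) / 2"
    by (simp add: power2_eq_square algebra_simps)
  also have "\<dots> powr (q / 2) \<le> (((a + b)\<^sup>2) powr (q / 2) + ((a - b)\<^sup>2) powr (q / 2)) / 2"
    using assms by (intro powr_midpoint) auto
  finally show ?thesis by (simp add: abs_powr_half)
qed

text \<open>The mirror image of the previous argument: raised to the power 2/p >= 1, both sides are
  compared with squares, convexity now serving the left side and superadditivity the right.\<close>

lemma clarkson_le2:
  fixes a b p :: real
  assumes "0 < p" "p \<le> 2"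
  shows "(\<bar>a + b\<bar> powr p + \<bar>a - b\<bar> powr p) / 2 \<le> \<bar>a\<bar> powr p + \<bar>b\<bar> powr p"
proof -
  define s where "s = 2 / p"
  have s: "1 \<le> s" "0 < s" using assms by (auto simp: s_def)
  have inv: "(\<bar>c\<bar> powr p) powr s = c\<^sup>2" for c :: real
    using assms by (simp add: s_def powr_powr)
  have "((\<bar>a + b\<bar> powr p + \<bar>a - b\<bar> powr p) / 2) powr s \<le> ((a + b)\<^sup>2 + (a - b)\<^sup>2) / 2"
    using powr_midpoint[OF s(1), of "\<bar>a + b\<bar> powr p" "\<bar>a - b\<bar> powr p"] by (simp add: inv)
  also have "\<dots> = (\<bar>a\<bar> powr p) powr s + (\<bar>b\<bar> powr p) powr s"
    by (simp add: inv power2_eq_square algebra_simps)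
  also have "\<dots> \<le> (\<bar>a\<bar> powr p + \<bar>b\<bar> powr p) powr s"
    by (rule powr_superadditive[OF s(1)]) auto
  finally show ?thesis
    using s(2) powr_less_mono2[of s "\<bar>a\<bar> powr p + \<bar>b\<bar> powr p" "(\<bar>a + b\<bar> powr p + \<bar>a - b\<bar> powr p) / 2"]
    by fastforce
qed

text \<open>The point a is the midpoint of a + b and a - b. This is what survives of Clarkson's
  inequality in a range with exponent below 2: convexity without the gain in b.\<close>

lemma abs_powr_jensen:
  fixes a b q :: real
  assumes "1 \<le> q"
  shows "\<bar>a\<bar> powr q \<le> (\<bar>a + b\<bar> powr q + \<bar>a - b\<bar> powr q) / 2"
proof -
  have "\<bar>a\<bar> powr q \<le> ((\<bar>a + b\<bar> + \<bar>a - b\<bar>) / 2) powr q"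
    using assms by (intro powr_mono2) auto
  also have "\<dots> \<le> (\<bar>a + b\<bar> powr q + \<bar>a - b\<bar> powr q) / 2"
    using assms by (intro powr_midpoint) auto
  finally show ?thesis .
qed

lemma abs_add_powr_le:
  fixes a b p :: real
  assumes "0 \<le> p"
  shows "\<bar>a + b\<bar> powr p \<le> 2 powr p * (\<bar>a\<bar> powr p + \<bar>b\<bar> powr p)"
proof -
  have "\<bar>a + b\<bar> powr p \<le> (2 * max \<bar>a\<bar> \<bar>b\<bar>) powr p"
    using assms by (intro powr_mono2) auto
  also have "\<dots> = 2 powr p * max \<bar>a\<bar> \<bar>b\<bar> powr p" by (simp add: powr_mult)
  also have "max \<bar>a\<bar> \<bar>b\<bar> powr p \<le> \<bar>a\<bar> powr p + \<bar>b\<bar> powr p" by (simp add: max_def)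
  finally show ?thesis by (simp add: mult_left_mono)
qed

text \<open>A sublinear power loses against a linear term. With r = q/p this is where q < p enters
  the perturbation argument.\<close>

lemma bdd_above_powr_minus_linear:
  fixes K r \<mu> :: real
  assumes "0 \<le> K" "0 \<le> r" "r < 1" "0 < \<mu>"
  obtains B where "\<And>y. 0 \<le> y \<Longrightarrow> K * y powr r - \<mu> * y \<le> B"
proof -
  \<comment> \<open>Y is the crossover point, at which K y^r = \<mu> y when K > 0; beyond it the
    difference is at most 0.\<close>
  define Y where "Y = (K / \<mu>) powr (1 / (1 - r))"
  have "K * y powr r - \<mu> * y \<le> K * Y powr r" if y: "0 \<le> y" for y
  proof (cases "y \<le> Y")
    case True
    have "K * y powr r \<le> K * Y powr r"
      using True y assms by (intro mult_left_mono powr_mono2) auto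
    then show ?thesis using y assms by (smt (verit) mult_nonneg_nonneg)
  next
    case False
    have "Y \<ge> 0" by (simp add: Y_def)
    have "K / \<mu> = Y powr (1 - r)" using assms by (simp add: Y_def powr_powr)
    also have "\<dots> \<le> y powr (1 - r)"
      using False assms \<open>Y \<ge> 0\<close> by (intro powr_mono2) auto
    finally have "K \<le> \<mu> * y powr (1 - r)" using assms by (simp add: field_simps)
    then have "K * y powr r \<le> \<mu> * y powr (1 - r) * y powr r"
      by (intro mult_right_mono) auto
    also have "\<dots> = \<mu> * y" using y by (simp add: powr_add[symmetric] mult.assoc)
    finally have "K * y powr r \<le> \<mu> * y" .
    moreover have "0 \<le> K * Y powr r" using assms by auto
    ultimately show ?thesis by linarith
  qed
  then show ?thesis by (rule that)
qed

text \<open>Takes the place of Hoelder's inequality in comparing exponents: on a probability space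
  the constant 1 integrates to 1.\<close>

lemma abs_le_one_plus_powr:
  fixes a q r :: real
  assumes "0 \<le> q" "q \<le> r"
  shows "\<bar>a\<bar> powr q \<le> 1 + \<bar>a\<bar> powr r"
proof (cases "\<bar>a\<bar> \<le> 1")
  case True
  then have "\<bar>a\<bar> powr q \<le> 1 powr q" using assms by (intro powr_mono2) auto
  then show ?thesis by (simp add: add_increasing2)
next
  case False
  then have "\<bar>a\<bar> powr q \<le> \<bar>a\<bar> powr r" using assms by (intro powr_mono) auto
  then show ?thesis by simp
qed

subsection \<open>The modular of \<open>L\<^sub>p\<close>\<close>

interpretation leb01: prob_space leb01
  by (rule prob_spaceI) (simp add: emeasure_restrict_space space_restrict_space)

text \<open>The p-th power of the norm. It is additive over disjoint supports and can be estimated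
  pointwise under the integral, so the perturbation argument is run with it and not with the
  norm.\<close>

lift_definition Lp_integral :: "real \<Rightarrow> L0 \<Rightarrow> real" is
  "\<lambda>p f. LINT x|leb01. \<bar>f x\<bar> powr p"
  by (intro integral_cong_AE) (auto elim: eventually_mono)

text \<open>Multiplication by the indicator of A. The default 0 for a non-measurable A keeps the
  result measurable, so that the operation is total in A.\<close>

lift_definition cut :: "real set \<Rightarrow> L0 \<Rightarrow> L0" is
  "\<lambda>A f x. if A \<in> sets leb01 then indicator A x * f x else 0"
  subgoal for A f g by (cases "A \<in> sets leb01") (auto elim: eventually_mono)
  done

lemma Lp_norm_eq: "Lp_norm p f = Lp_integral p f powr (1 / p)"
  by transfer simp

lemma Lp_integral_nonneg [simp]: "0 \<le> Lp_integral p f"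
  by transfer simp

lemma Lp_norm_nonneg [simp]: "0 \<le> Lp_norm p f"
  by (simp add: Lp_norm_eq)

lemma Lp_integral_eq: "0 < p \<Longrightarrow> Lp_integral p f = Lp_norm p f powr p"
  using powr_powr[of "Lp_integral p f" "1 / p" p] by (simp add: Lp_norm_eq)

lemma Lp_mem_zero [simp]: "Lp_mem p 0"
  by transfer simp

lemma Lp_mem_scaleR: "Lp_mem p f \<Longrightarrow> Lp_mem p (c *\<^sub>R f)"
  by transfer (simp add: abs_mult powr_mult)

lemma Lp_integral_scaleR: "Lp_integral p (c *\<^sub>R f) = \<bar>c\<bar> powr p * Lp_integral p f"
  by transfer (simp add: abs_mult powr_mult)

lemma Lp_norm_scaleR: "0 < p \<Longrightarrow> Lp_norm p (c *\<^sub>R f) = \<bar>c\<bar> * Lp_norm p f"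
  using powr_powr[of "\<bar>c\<bar>" p "1 / p"] by (simp add: Lp_norm_eq Lp_integral_scaleR powr_mult)

lemma Lp_norm_zero [simp]: "0 < p \<Longrightarrow> Lp_norm p 0 = 0"
  using Lp_norm_scaleR[of p 0 0] by simp

lemma Lp_mem_mono: "0 \<le> q \<Longrightarrow> q \<le> r \<Longrightarrow> Lp_mem r f \<Longrightarrow> Lp_mem q f"
proof (transfer)
  fix q r :: real and f :: "real \<Rightarrow> real"
  assume q: "0 \<le> q" "q \<le> r" and m: "f \<in> borel_measurable leb01 \<and> f \<in> borel_measurable leb01 \<and> (AE x in leb01. f x = f x)"
   and i: "integrable leb01 (\<lambda>x. \<bar>f x\<bar> powr r)"
  have [measurable]: "f \<in> borel_measurable leb01" using m by auto
  have "integrable leb01 (\<lambda>x. 1 + \<bar>f x\<bar> powr r)" using i by auto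
  then show "integrable leb01 (\<lambda>x. \<bar>f x\<bar> powr q)"
    by (rule Bochner_Integration.integrable_bound) (use abs_le_one_plus_powr[OF q] in auto)
qed

lemma Lp_mem_add: "0 \<le> p \<Longrightarrow> Lp_mem p f \<Longrightarrow> Lp_mem p g \<Longrightarrow> Lp_mem p (f + g)"
proof (transfer)
  fix p :: real and f g :: "real \<Rightarrow> real"
  assume p: "0 \<le> p" and m: "f \<in> borel_measurable leb01 \<and> f \<in> borel_measurable leb01 \<and> (AE x in leb01. f x = f x)"
     "g \<in> borel_measurable leb01 \<and> g \<in> borel_measurable leb01 \<and> (AE x in leb01. g x = g x)"
   and i: "integrable leb01 (\<lambda>x. \<bar>f x\<bar> powr p)" "integrable leb01 (\<lambda>x. \<bar>g x\<bar> powr p)"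
  have [measurable]: "f \<in> borel_measurable leb01" "g \<in> borel_measurable leb01" using m by auto
  have "integrable leb01 (\<lambda>x. 2 powr p * (\<bar>f x\<bar> powr p + \<bar>g x\<bar> powr p))"
    using i by auto
  then show "integrable leb01 (\<lambda>x. \<bar>f x + g x\<bar> powr p)"
    by (rule Bochner_Integration.integrable_bound) (use abs_add_powr_le[OF p] in auto)
qed

lemma Lp_mem_minus: "Lp_mem p f \<Longrightarrow> Lp_mem p (- f)"
  using Lp_mem_scaleR[of p f "-1"] by simp

lemma Lp_mem_diff: "0 \<le> p \<Longrightarrow> Lp_mem p f \<Longrightarrow> Lp_mem p g \<Longrightarrow> Lp_mem p (f - g)"
  using Lp_mem_add[of p f "- g"] Lp_mem_minus by simp

lemma Lp_norm_minus: "Lp_norm p (- f) = Lp_norm p f"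
  by transfer simp

lemma Lp_norm_commute: "Lp_norm p (f - g) = Lp_norm p (g - f)"
  using Lp_norm_minus[of p "f - g"] by simp

lemma Lp_integral_le_iff:
  "0 < p \<Longrightarrow> 0 \<le> c \<Longrightarrow> Lp_integral p f \<le> c powr p \<longleftrightarrow> Lp_norm p f \<le> c"
  using powr_mono2[of p "Lp_norm p f" c] powr_less_mono2[of p c "Lp_norm p f"]
  by (cases "Lp_norm p f \<le> c") (simp_all add: Lp_integral_eq)

lemma Lp_mem_cut: "Lp_mem p f \<Longrightarrow> Lp_mem p (cut A f)"
proof (transfer)
  fix p :: real and f :: "real \<Rightarrow> real" and A
  assume m: "f \<in> borel_measurable leb01 \<and> f \<in> borel_measurable leb01 \<and> (AE x in leb01. f x = f x)"
   and i: "integrable leb01 (\<lambda>x. \<bar>f x\<bar> powr p)"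
  have [measurable]: "f \<in> borel_measurable leb01" using m by auto
  show "integrable leb01 (\<lambda>x. \<bar>if A \<in> sets leb01 then indicator A x * f x else 0\<bar> powr p)"
    by (cases "A \<in> sets leb01"; rule Bochner_Integration.integrable_bound[OF i]) (auto simp: indicator_def)
qed

lemma Lp_integral_clarkson_ge2:
  assumes "2 \<le> q" "Lp_mem q f" "Lp_mem q g"
  shows "Lp_integral q f + Lp_integral q g \<le> (Lp_integral q (f + g) + Lp_integral q (f - g)) / 2"
  using assms(2,3) Lp_mem_add[OF _ assms(2,3)] Lp_mem_diff[OF _ assms(2,3)]
proof (transfer fixing: q)
  fix f g :: "real \<Rightarrow> real"
  assume i: "integrable leb01 (\<lambda>x. \<bar>f x\<bar> powr q)" "integrable leb01 (\<lambda>x. \<bar>g x\<bar> powr q)"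
    "0 \<le> q \<Longrightarrow> integrable leb01 (\<lambda>x. \<bar>f x + g x\<bar> powr q)" "0 \<le> q \<Longrightarrow> integrable leb01 (\<lambda>x. \<bar>f x - g x\<bar> powr q)"
  have "(LINT x|leb01. \<bar>f x\<bar> powr q + \<bar>g x\<bar> powr q) \<le> (LINT x|leb01. (\<bar>f x + g x\<bar> powr q + \<bar>f x - g x\<bar> powr q) / 2)"
    using i assms(1) by (intro integral_mono clarkson_ge2) auto
  then show "(LINT x|leb01. \<bar>f x\<bar> powr q) + (LINT x|leb01. \<bar>g x\<bar> powr q) \<le> ((LINT x|leb01. \<bar>f x + g x\<bar> powr q) + (LINT x|leb01. \<bar>f x - g x\<bar> powr q)) / 2"
    using i assms(1) by simp
qed

lemma Lp_integral_clarkson_le2: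
  assumes "0 < p" "p \<le> 2" "Lp_mem p f" "Lp_mem p g"
  shows "(Lp_integral p (f + g) + Lp_integral p (f - g)) / 2 \<le> Lp_integral p f + Lp_integral p g"
  using assms(3,4) Lp_mem_add[OF _ assms(3,4)] Lp_mem_diff[OF _ assms(3,4)]
proof (transfer fixing: p)
  fix f g :: "real \<Rightarrow> real"
  assume i: "integrable leb01 (\<lambda>x. \<bar>f x\<bar> powr p)" "integrable leb01 (\<lambda>x. \<bar>g x\<bar> powr p)"
    "0 \<le> p \<Longrightarrow> integrable leb01 (\<lambda>x. \<bar>f x + g x\<bar> powr p)" "0 \<le> p \<Longrightarrow> integrable leb01 (\<lambda>x. \<bar>f x - g x\<bar> powr p)"
  have "(LINT x|leb01. (\<bar>f x + g x\<bar> powr p + \<bar>f x - g x\<bar> powr p) / 2) \<le> (LINT x|leb01. \<bar>f x\<bar> powr p + \<bar>g x\<bar> powr p)"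
    using i assms(1,2) by (intro integral_mono clarkson_le2) auto
  then show "((LINT x|leb01. \<bar>f x + g x\<bar> powr p) + (LINT x|leb01. \<bar>f x - g x\<bar> powr p)) / 2 \<le> (LINT x|leb01. \<bar>f x\<bar> powr p) + (LINT x|leb01. \<bar>g x\<bar> powr p)"
    using i assms(1) by simp
qed

text \<open>The midpoint inequality is applied with centre f off A and with centre g on A, where the
  roles of f and g are exchanged. The left side is thus the integral of |f|^q off A plus that of
  |g|^q on A.\<close>

lemma Lp_integral_jensen_cut:
  assumes "1 \<le> q" "Lp_mem q f" "Lp_mem q g" and A: "A \<in> sets leb01"
  shows "Lp_integral q f - Lp_integral q (cut A f) + Lp_integral q (cut A g)
    \<le> (Lp_integral q (f + g) + Lp_integral q (f - g)) / 2"
  using assms(2,3) Lp_mem_add[OF _ assms(2,3)] Lp_mem_diff[OF _ assms(2,3)]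
    Lp_mem_cut[OF assms(2), of A] Lp_mem_cut[OF assms(3), of A]
proof (transfer fixing: q A)
  fix f g :: "real \<Rightarrow> real"
  let ?cut = "\<lambda>f x. if A \<in> sets leb01 then indicator A x * f x else 0 :: real"
  assume i: "integrable leb01 (\<lambda>x. \<bar>f x\<bar> powr q)" "integrable leb01 (\<lambda>x. \<bar>g x\<bar> powr q)"
    "0 \<le> q \<Longrightarrow> integrable leb01 (\<lambda>x. \<bar>f x + g x\<bar> powr q)" "0 \<le> q \<Longrightarrow> integrable leb01 (\<lambda>x. \<bar>f x - g x\<bar> powr q)"
    "integrable leb01 (\<lambda>x. \<bar>?cut f x\<bar> powr q)" "integrable leb01 (\<lambda>x. \<bar>?cut g x\<bar> powr q)"
  have pw: "\<bar>f x\<bar> powr q - \<bar>?cut f x\<bar> powr q + \<bar>?cut g x\<bar> powr q \<le> (\<bar>f x + g x\<bar> powr q + \<bar>f x - g x\<bar> powr q) / 2" for x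
    using abs_powr_jensen[OF assms(1), of "f x" "g x"] abs_powr_jensen[OF assms(1), of "g x" "f x"] A
    by (cases "x \<in> A") (auto simp: abs_minus_commute add.commute)
  have "(LINT x|leb01. \<bar>f x\<bar> powr q - \<bar>?cut f x\<bar> powr q + \<bar>?cut g x\<bar> powr q) \<le> (LINT x|leb01. (\<bar>f x + g x\<bar> powr q + \<bar>f x - g x\<bar> powr q) / 2)"
    using i assms(1) by (intro integral_mono pw integrable_add integrable_diff integrable_divide) auto
  then show "(LINT x|leb01. \<bar>f x\<bar> powr q) - (LINT x|leb01. \<bar>?cut f x\<bar> powr q) + (LINT x|leb01. \<bar>?cut g x\<bar> powr q)
     \<le> ((LINT x|leb01. \<bar>f x + g x\<bar> powr q) + (LINT x|leb01. \<bar>f x - g x\<bar> powr q)) / 2"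
    using i assms(1) by (simp del: A)
qed

text \<open>Off A nothing changes; on A the crude bound 2^p (|f|^p + |g|^p) suffices, because f will
  carry little mass there.\<close>

lemma Lp_integral_add_cut_le:
  assumes "0 \<le> p" "Lp_mem p f" "Lp_mem p g" and A: "A \<in> sets leb01"
  shows "Lp_integral p (f + cut A g) \<le> Lp_integral p f + 2 powr p * (Lp_integral p (cut A f) + Lp_integral p g)"
  using assms(2,3) Lp_mem_add[OF _ assms(2) Lp_mem_cut[OF assms(3), of A]]
    Lp_mem_cut[OF assms(2), of A]
proof (transfer fixing: p A)
  fix f g :: "real \<Rightarrow> real"
  let ?cut = "\<lambda>f x. if A \<in> sets leb01 then indicator A x * f x else 0 :: real"
  assume i: "integrable leb01 (\<lambda>x. \<bar>f x\<bar> powr p)" "integrable leb01 (\<lambda>x. \<bar>g x\<bar> powr p)"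
    "0 \<le> p \<Longrightarrow> integrable leb01 (\<lambda>x. \<bar>f x + ?cut g x\<bar> powr p)"
    "integrable leb01 (\<lambda>x. \<bar>?cut f x\<bar> powr p)"
  have pw: "\<bar>f x + ?cut g x\<bar> powr p \<le> \<bar>f x\<bar> powr p + 2 powr p * (\<bar>?cut f x\<bar> powr p + \<bar>g x\<bar> powr p)" for x
    using abs_add_powr_le[OF assms(1), of "f x" "g x"] A
    by (cases "x \<in> A") (auto intro: add_increasing)
  have "(LINT x|leb01. \<bar>f x + ?cut g x\<bar> powr p) \<le> (LINT x|leb01. \<bar>f x\<bar> powr p + 2 powr p * (\<bar>?cut f x\<bar> powr p + \<bar>g x\<bar> powr p))"
    using i assms(1) by (intro integral_mono pw integrable_add integrable_mult_right) auto
  then show "(LINT x|leb01. \<bar>f x + ?cut g x\<bar> powr p)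
     \<le> (LINT x|leb01. \<bar>f x\<bar> powr p) + 2 powr p * ((LINT x|leb01. \<bar>?cut f x\<bar> powr p) + (LINT x|leb01. \<bar>g x\<bar> powr p))"
    using i assms(1) by (simp del: A)
qed

lemma Lp_integral_split:
  assumes "0 \<le> p" "Lp_mem p f" and A: "A \<in> sets leb01"
  shows "Lp_integral p f = Lp_integral p (cut A f) + Lp_integral p (f - cut A f)"
  using assms(2) Lp_mem_diff[OF _ assms(2) Lp_mem_cut[OF assms(2), of A]]
    Lp_mem_cut[OF assms(2), of A]
proof (transfer fixing: p A)
  fix f :: "real \<Rightarrow> real"
  let ?cut = "\<lambda>f x. if A \<in> sets leb01 then indicator A x * f x else 0 :: real"
  assume i: "integrable leb01 (\<lambda>x. \<bar>f x\<bar> powr p)"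
    "0 \<le> p \<Longrightarrow> integrable leb01 (\<lambda>x. \<bar>f x - ?cut f x\<bar> powr p)"
    "integrable leb01 (\<lambda>x. \<bar>?cut f x\<bar> powr p)"
  have pw: "\<bar>f x\<bar> powr p = \<bar>?cut f x\<bar> powr p + \<bar>f x - ?cut f x\<bar> powr p" for x
    using A by (cases "x \<in> A") auto
  have "(LINT x|leb01. \<bar>f x\<bar> powr p) = (LINT x|leb01. \<bar>?cut f x\<bar> powr p + \<bar>f x - ?cut f x\<bar> powr p)"
    by (intro Bochner_Integration.integral_cong refl pw)
  also have "\<dots> = (LINT x|leb01. \<bar>?cut f x\<bar> powr p) + (LINT x|leb01. \<bar>f x - ?cut f x\<bar> powr p)"
    using i assms(1) by (intro Bochner_Integration.integral_add) auto
  finally show "(LINT x|leb01. \<bar>f x\<bar> powr p) = (LINT x|leb01. \<bar>?cut f x\<bar> powr p) + (LINT x|leb01. \<bar>f x - ?cut f x\<bar> powr p)" .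
qed

lemma Lp_norm_eq_0: "0 < p \<Longrightarrow> Lp_mem p f \<Longrightarrow> Lp_norm p f = 0 \<Longrightarrow> f = 0"
proof transfer
  fix p :: real and f :: "real \<Rightarrow> real"
  assume p: "0 < p" and m: "f \<in> borel_measurable leb01 \<and> f \<in> borel_measurable leb01 \<and> (AE x in leb01. f x = f x)"
   and i: "integrable leb01 (\<lambda>x. \<bar>f x\<bar> powr p)" "(LINT x|leb01. \<bar>f x\<bar> powr p) powr (1 / p) = 0"
  have "AE x in leb01. \<bar>f x\<bar> powr p = 0"
    using i by (subst (asm) powr_eq_0_iff, subst (asm) integral_nonneg_eq_0_iff_AE) auto
  then have "AE x in leb01. f x = 0" by simp
  then show "f \<in> borel_measurable leb01 \<and> (\<lambda>_. 0) \<in> borel_measurable leb01 \<and> (AE x in leb01. f x = 0)"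
    using m by simp
qed

lemma Lp_integral_convex:
  assumes "1 \<le> p" "0 \<le> t" "t \<le> 1" "Lp_mem p f" "Lp_mem p g"
  shows "Lp_integral p (t *\<^sub>R f + (1 - t) *\<^sub>R g) \<le> t * Lp_integral p f + (1 - t) * Lp_integral p g"
  using assms(4,5) Lp_mem_add[OF _ Lp_mem_scaleR[OF assms(4), of t] Lp_mem_scaleR[OF assms(5), of "1 - t"]]
proof (transfer fixing: p t)
  fix f g :: "real \<Rightarrow> real"
  assume i: "integrable leb01 (\<lambda>x. \<bar>f x\<bar> powr p)" "integrable leb01 (\<lambda>x. \<bar>g x\<bar> powr p)"
    "0 \<le> p \<Longrightarrow> integrable leb01 (\<lambda>x. \<bar>t * f x + (1 - t) * g x\<bar> powr p)"
  have pw: "\<bar>t * f x + (1 - t) * g x\<bar> powr p \<le> t * \<bar>f x\<bar> powr p + (1 - t) * \<bar>g x\<bar> powr p" for x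
  proof -
    have "\<bar>t * f x + (1 - t) * g x\<bar> \<le> t * \<bar>f x\<bar> + (1 - t) * \<bar>g x\<bar>"
      using assms by (intro order.trans[OF abs_triangle_ineq]) (simp add: abs_mult)
    then have "\<bar>t * f x + (1 - t) * g x\<bar> powr p \<le> (t * \<bar>f x\<bar> + (1 - t) * \<bar>g x\<bar>) powr p"
      using assms by (intro powr_mono2) auto
    also have "\<dots> \<le> t * \<bar>f x\<bar> powr p + (1 - t) * \<bar>g x\<bar> powr p"
      using assms by (intro powr_convex_combination) auto
    finally show ?thesis .
  qed
  have "(LINT x|leb01. \<bar>t * f x + (1 - t) * g x\<bar> powr p) \<le> (LINT x|leb01. t * \<bar>f x\<bar> powr p + (1 - t) * \<bar>g x\<bar> powr p)"
    using i assms(1) by (intro integral_mono pw integrable_add integrable_mult_right) auto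
  then show "(LINT x|leb01. \<bar>t * f x + (1 - t) * g x\<bar> powr p) \<le> t * (LINT x|leb01. \<bar>f x\<bar> powr p) + (1 - t) * (LINT x|leb01. \<bar>g x\<bar> powr p)"
    using i by simp
qed

text \<open>Minkowski's inequality from convexity of the modular: the unit ball is convex, and
  normalising f and g reduces the claim to that. Vanishing norms are treated apart because of the
  division.\<close>

lemma Lp_norm_triangle:
  assumes "1 \<le> p" "Lp_mem p f" "Lp_mem p g"
  shows "Lp_norm p (f + g) \<le> Lp_norm p f + Lp_norm p g"
proof -
  define a where "a = Lp_norm p f"
  define b where "b = Lp_norm p g"
  have p: "0 < p" using assms by simp
  have ab: "0 \<le> a" "0 \<le> b" by (auto simp: a_def b_def)
  consider "a = 0" | "b = 0" | "0 < a" "0 < b" using ab by linarith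
  then show ?thesis
  proof cases
    case 1 then show ?thesis using Lp_norm_eq_0[OF p assms(2)] by (simp add: a_def)
  next
    case 2 then show ?thesis using Lp_norm_eq_0[OF p assms(3)] by (simp add: b_def)
  next
    case 3
    \<comment> \<open>With this weight (f + g) / (a + b) is the convex combination of f / a and g /
      b.\<close>
    define t where "t = a / (a + b)"
    have t: "0 \<le> t" "t \<le> 1" "1 - t = b / (a + b)" using 3 by (auto simp: t_def field_simps)
    have unit: "Lp_integral p ((1 / a) *\<^sub>R f) = 1" "Lp_integral p ((1 / b) *\<^sub>R g) = 1"
      using 3 p by (simp_all add: Lp_integral_eq Lp_norm_scaleR a_def[symmetric] b_def[symmetric])
    have "(1 / (a + b)) *\<^sub>R (f + g) = t *\<^sub>R ((1 / a) *\<^sub>R f) + (1 - t) *\<^sub>R ((1 / b) *\<^sub>R g)"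
      using 3 unfolding t(3) by (simp add: t_def scaleR_add_right)
    then have "Lp_integral p ((1 / (a + b)) *\<^sub>R (f + g)) \<le> t * 1 + (1 - t) * 1"
      using Lp_integral_convex[OF assms(1) t(1,2) Lp_mem_scaleR[OF assms(2), of "1 / a"] Lp_mem_scaleR[OF assms(3), of "1 / b"]]
      by (simp only: unit)
    then have "Lp_integral p ((1 / (a + b)) *\<^sub>R (f + g)) \<le> 1 powr p" by simp
    then have "Lp_norm p ((1 / (a + b)) *\<^sub>R (f + g)) \<le> 1"
      by (rule iffD1[OF Lp_integral_le_iff[OF p zero_le_one]])
    then show ?thesis unfolding Lp_norm_scaleR[OF p] using 3 by (simp add: a_def[symmetric] b_def[symmetric] field_simps)
  qed
qed

lemma Lp_integral_le_one_plus:
  assumes "0 \<le> q" "q \<le> r" "Lp_mem r f"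
  shows "Lp_integral q f \<le> 1 + Lp_integral r f"
  using assms(3) Lp_mem_mono[OF assms]
proof (transfer fixing: q r)
  fix f :: "real \<Rightarrow> real"
  assume i: "integrable leb01 (\<lambda>x. \<bar>f x\<bar> powr r)" "integrable leb01 (\<lambda>x. \<bar>f x\<bar> powr q)"
  have "(LINT x|leb01. \<bar>f x\<bar> powr q) \<le> (LINT x|leb01. 1 + \<bar>f x\<bar> powr r)"
    using i by (intro integral_mono abs_le_one_plus_powr[OF assms(1,2)]) auto
  then show "(LINT x|leb01. \<bar>f x\<bar> powr q) \<le> 1 + (LINT x|leb01. \<bar>f x\<bar> powr r)"
    using i leb01.prob_space by simp
qed

text \<open>For |f|_r = 1 the modular of exponent q is at most 1 + 1, whence the factor 2^(1/q). It
  is not sharp, but only the existence of a constant matters.\<close>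

lemma Lp_norm_mono_exponent:
  assumes "0 < q" "q \<le> r" "Lp_mem r f"
  shows "Lp_norm q f \<le> 2 powr (1 / q) * Lp_norm r f"
proof (cases "Lp_norm r f = 0")
  case True
  then have "f = 0" using assms by (intro Lp_norm_eq_0[of r]) auto
  then show ?thesis using assms by simp
next
  case False
  define c where "c = Lp_norm r f"
  have c: "c > 0" using False Lp_norm_nonneg[of r f] unfolding c_def by linarith
  have "Lp_integral q ((1 / c) *\<^sub>R f) \<le> 1 + Lp_integral r ((1 / c) *\<^sub>R f)"
    using assms by (intro Lp_integral_le_one_plus Lp_mem_scaleR) auto
  also have "Lp_integral r ((1 / c) *\<^sub>R f) = 1"
    using c assms by (simp add: Lp_integral_eq Lp_norm_scaleR c_def[symmetric])
  finally have "Lp_integral q ((1 / c) *\<^sub>R f) \<le> (2 powr (1 / q)) powr q"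
    using assms(1) by (simp add: powr_powr)
  then have "Lp_norm q ((1 / c) *\<^sub>R f) \<le> 2 powr (1 / q)"
    using Lp_integral_le_iff[OF assms(1)] by simp
  then show ?thesis using c assms by (simp add: Lp_norm_scaleR c_def[symmetric] field_simps)
qed

subsection \<open>Truncation, absolute continuity and completeness\<close>

text \<open>Chebyshev's inequality for the set where |f| exceeds m; removing that set truncates f at
  height m.\<close>

lemma ex_cut_esssup_le:
  assumes "0 < q" "0 < m"
  shows "Lp_mem q f \<Longrightarrow> \<exists>A\<in>sets leb01. measure leb01 A * m powr q \<le> Lp_integral q f
    \<and> L0_esssup (f - cut A f) \<le> ereal m"
proof (transfer fixing: q m)
  fix f :: "real \<Rightarrow> real"
  assume f: "f \<in> borel_measurable leb01 \<and> f \<in> borel_measurable leb01 \<and> (AE x in leb01. f x = f x)"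
    and i: "integrable leb01 (\<lambda>x. \<bar>f x\<bar> powr q)"
  have [measurable]: "f \<in> borel_measurable leb01" using f by auto
  define A where "A = {x \<in> space leb01. m < \<bar>f x\<bar>}"
  have A [measurable]: "A \<in> sets leb01" unfolding A_def by measurable
  have "measure leb01 A * m powr q = (LINT x|leb01. indicator A x * m powr q)"
    using A sets.sets_into_space[OF A] by (simp add: Int_absorb1 Int_absorb2)
  also have "\<dots> \<le> (LINT x|leb01. \<bar>f x\<bar> powr q)"
  proof (intro integral_mono i)
    show "indicator A x * m powr q \<le> \<bar>f x\<bar> powr q" for x
      using assms by (auto simp: A_def indicator_def intro!: powr_mono2)
  qed (simp add: leb01.emeasure_eq_measure)
  finally have 1: "measure leb01 A * m powr q \<le> (LINT x|leb01. \<bar>f x\<bar> powr q)" .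
  have 2: "esssup leb01 (\<lambda>x. ereal \<bar>f x - (if A \<in> sets leb01 then indicator A x * f x else 0)\<bar>) \<le> ereal m"
  proof (rule esssup_I)
    show "AE x in leb01. ereal \<bar>f x - (if A \<in> sets leb01 then indicator A x * f x else 0)\<bar> \<le> ereal m"
      using assms A by (intro AE_I2) (auto simp: A_def indicator_def)
  qed (use A in simp)
  from 1 2 A show "\<exists>A\<in>sets leb01. measure leb01 A * m powr q \<le> (LINT x|leb01. \<bar>f x\<bar> powr q) \<and>
    esssup leb01 (\<lambda>x. ereal \<bar>f x - (if A \<in> sets leb01 then indicator A x * f x else 0)\<bar>) \<le> ereal m"
    by blast
qed

lemma Lp_bounded:
  assumes "0 < p" "0 \<le> m"
  shows "L0_esssup f \<le> ereal m \<Longrightarrow> Lp_mem p f \<and> Lp_integral p f \<le> m powr p"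
proof (transfer fixing: p m)
  fix f :: "real \<Rightarrow> real"
  assume f: "f \<in> borel_measurable leb01 \<and> f \<in> borel_measurable leb01 \<and> (AE x in leb01. f x = f x)"
    and e: "esssup leb01 (\<lambda>x. ereal \<bar>f x\<bar>) \<le> ereal m"
  have [measurable]: "f \<in> borel_measurable leb01" using f by auto
  have "AE x in leb01. ereal \<bar>f x\<bar> \<le> ereal m"
    by (rule eventually_mono[OF esssup_AE[of "\<lambda>x. ereal \<bar>f x\<bar>" leb01]]) (rule order.trans[OF _ e])
  then have ae: "AE x in leb01. \<bar>f x\<bar> powr p \<le> m powr p"
    by (rule eventually_mono) (use assms in \<open>auto intro!: powr_mono2\<close>)
  then have i: "integrable leb01 (\<lambda>x. \<bar>f x\<bar> powr p)"
    by (intro leb01.integrable_const_bound[where B = "m powr p"]) auto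
  then have "(LINT x|leb01. \<bar>f x\<bar> powr p) \<le> (LINT x|leb01. m powr p)"
    by (intro integral_mono_AE ae) auto
  then show "integrable leb01 (\<lambda>x. \<bar>f x\<bar> powr p) \<and> (LINT x|leb01. \<bar>f x\<bar> powr p) \<le> m powr p"
    using i leb01.prob_space by simp
qed

text \<open>Write |f|^p as its part above height n, whose integral is small by dominated
  convergence, plus a part bounded by n, which contributes at most n times the measure of A.\<close>

lemma Lp_integral_absolutely_continuous:
  assumes "0 < \<epsilon>"
  shows "Lp_mem p f \<Longrightarrow> \<exists>t>0. \<forall>A\<in>sets leb01. measure leb01 A \<le> t \<longrightarrow> Lp_integral p (cut A f) \<le> \<epsilon>"
proof (transfer fixing: p \<epsilon>)
  fix f :: "real \<Rightarrow> real"
  assume f: "f \<in> borel_measurable leb01 \<and> f \<in> borel_measurable leb01 \<and> (AE x in leb01. f x = f x)"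
    and i: "integrable leb01 (\<lambda>x. \<bar>f x\<bar> powr p)"
  have [measurable]: "f \<in> borel_measurable leb01" using f by auto
  define g where "g x = \<bar>f x\<bar> powr p" for x
  have g [measurable]: "g \<in> borel_measurable leb01" unfolding g_def by measurable
  have ig: "integrable leb01 g" using i unfolding g_def .
  define h where "h n x = (if g x > real n then g x else 0)" for n x
  have [measurable]: "h n \<in> borel_measurable leb01" for n unfolding h_def by measurable
  have ih: "integrable leb01 (h n)" for n
    by (rule Bochner_Integration.integrable_bound[OF ig]) (auto simp: h_def)
  have "(\<lambda>n. LINT x|leb01. h n x) \<longlonglongrightarrow> (LINT x|leb01. 0)"
  proof (rule integral_dominated_convergence[where w = g])
    show "AE x in leb01. (\<lambda>n. h n x) \<longlonglongrightarrow> 0"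
    proof (rule AE_I2)
      fix x
      obtain N where N: "g x \<le> real N" using real_arch_simple by blast
      have "h n x = 0" if "n \<ge> N" for n using N that by (auto simp: h_def)
      then show "(\<lambda>n. h n x) \<longlonglongrightarrow> 0" by (intro tendsto_eventually eventually_sequentiallyI[of N])
    qed
    show "AE x in leb01. norm (h n x) \<le> g x" for n
      by (rule AE_I2) (auto simp: h_def g_def)
  qed (use ig in auto)
  then have "eventually (\<lambda>n. (LINT x|leb01. h n x) < \<epsilon> / 2) sequentially"
    using assms by (intro order_tendstoD(2)) auto
  then obtain n where n: "(LINT x|leb01. h n x) < \<epsilon> / 2"
    by (auto simp: eventually_sequentially)
  \<comment> \<open>The denominator uses n + 1 because n may be 0.\<close>
  define t where "t = \<epsilon> / (2 * (real n + 1))"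
  have t: "t > 0" "real n * t \<le> \<epsilon> / 2" using assms by (auto simp: t_def field_simps)
  have "(LINT x|leb01. \<bar>if A \<in> sets leb01 then indicator A x * f x else 0\<bar> powr p) \<le> \<epsilon>"
    if A [measurable]: "A \<in> sets leb01" and "measure leb01 A \<le> t" for A
  proof -
    have ia: "integrable leb01 (\<lambda>x. real n * indicator A x)"
      using A by (simp add: leb01.emeasure_eq_measure)
    have "(LINT x|leb01. \<bar>if A \<in> sets leb01 then indicator A x * f x else 0\<bar> powr p)
        \<le> (LINT x|leb01. h n x + real n * indicator A x)"
    proof (rule integral_mono)
      show "integrable leb01 (\<lambda>x. \<bar>if A \<in> sets leb01 then indicator A x * f x else 0\<bar> powr p)"
        by (rule Bochner_Integration.integrable_bound[OF i]) (use A in \<open>auto simp: indicator_def\<close>)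
      show "\<bar>if A \<in> sets leb01 then indicator A x * f x else 0\<bar> powr p \<le> h n x + real n * indicator A x" for x
        using A by (cases "x \<in> A") (auto simp: h_def g_def)
    qed (use ih ia in auto)
    also have "\<dots> = (LINT x|leb01. h n x) + real n * measure leb01 A"
      using ih ia A sets.sets_into_space[OF A] by (simp add: Int_absorb1 Int_absorb2)
    also have "\<dots> \<le> \<epsilon>"
      using n t(2) mult_left_mono[OF that(2), of "real n"] by simp
    finally show ?thesis .
  qed
  then show "\<exists>t>0. \<forall>A\<in>sets leb01. measure leb01 A \<le> t \<longrightarrow>
      (LINT x|leb01. \<bar>if A \<in> sets leb01 then indicator A x * f x else 0\<bar> powr p) \<le> \<epsilon>"
    using t(1) by blast
qed

section \<open>Completeness of L_q\<close>

text \<open>On a finite measure space the sequence is also Cauchy in L_1, so a subsequence converges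
  almost everywhere. Fatou's lemma along that subsequence, with the other index fixed, yields
  convergence of the whole sequence in the modular.\<close>

lemma (in finite_measure) Lp_Cauchy_converges:
  fixes s :: "nat \<Rightarrow> 'a \<Rightarrow> real"
  assumes q: "1 \<le> q" and [measurable]: "\<And>n. s n \<in> borel_measurable M"
    and int1: "\<And>i. integrable M (s i)"
    and int: "\<And>i j. integrable M (\<lambda>x. \<bar>s i x - s j x\<bar> powr q)"
    and Cauchy: "\<And>e. 0 < e \<Longrightarrow> \<exists>N. \<forall>i\<ge>N. \<forall>j\<ge>N. (LINT x|M. \<bar>s i x - s j x\<bar> powr q) < e"
  obtains l where "l \<in> borel_measurable M"
    "\<And>e. 0 < e \<Longrightarrow> \<exists>N. \<forall>i\<ge>N. integrable M (\<lambda>x. \<bar>s i x - l x\<bar> powr q) \<and> (LINT x|M. \<bar>s i x - l x\<bar> powr q) \<le> e"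
proof -
  have "\<exists>N. \<forall>i\<ge>N. \<forall>j\<ge>N. (LINT x|M. norm (s i x - s j x)) < e" if e: "0 < e" for e
  proof -
    \<comment> \<open>The summand 1 keeps K positive when the whole space is null.\<close>
    define K where "K = measure M (space M) + 1"
    have K: "0 < K" by (simp add: K_def add_nonneg_pos)
    define \<eta> where "\<eta> = e / (2 * K)"
    have \<eta>: "0 < \<eta>" using e K by (simp add: \<eta>_def)
    have "\<eta> * measure M (space M) \<le> \<eta> * K"
      using \<eta> by (simp add: K_def)
    also have "\<dots> = e / 2" using K by (simp add: \<eta>_def)
    finally have \<eta>': "\<eta> * measure M (space M) \<le> e / 2" .
    \<comment> \<open>This is \<eta>^(1-q). The bound |a| <= \<eta> + C |a|^q arises from the
      inequality |b| <= 1 + |b|^q at b = a / \<eta>, multiplied by \<eta>; its constant term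
      integrates to at most e/2.\<close>
    define C where "C = \<eta> * (1 / \<eta>) powr q"
    have C: "0 < C" using \<eta> by (simp add: C_def)
    obtain N where N: "\<And>i j. i \<ge> N \<Longrightarrow> j \<ge> N \<Longrightarrow> (LINT x|M. \<bar>s i x - s j x\<bar> powr q) < e / (2 * C)"
      using Cauchy[of "e / (2 * C)"] e C by auto
    have "(LINT x|M. norm (s i x - s j x)) < e" if "i \<ge> N" "j \<ge> N" for i j
    proof -
      have pw: "\<bar>a\<bar> \<le> \<eta> + C * \<bar>a\<bar> powr q" for a :: real
      proof -
        have "\<bar>a / \<eta>\<bar> powr 1 \<le> 1 + \<bar>a / \<eta>\<bar> powr q"
          by (rule abs_le_one_plus_powr) (use q in auto)
        moreover have "\<bar>a / \<eta>\<bar> powr q = \<bar>a\<bar> powr q * (1 / \<eta>) powr q"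
          using \<eta> by (simp add: powr_mult[symmetric])
        ultimately have "\<eta> * (\<bar>a\<bar> / \<eta>) \<le> \<eta> * (1 + \<bar>a\<bar> powr q * (1 / \<eta>) powr q)"
          using \<eta> by (intro mult_left_mono) auto
        then show ?thesis using \<eta> by (simp add: C_def algebra_simps)
      qed
      have "(LINT x|M. norm (s i x - s j x)) \<le> (LINT x|M. \<eta> + C * \<bar>s i x - s j x\<bar> powr q)"
        using int1 int pw by (intro integral_mono integrable_add integrable_norm Bochner_Integration.integrable_diff) auto
      also have "\<dots> = \<eta> * measure M (space M) + C * (LINT x|M. \<bar>s i x - s j x\<bar> powr q)"
        using int by simp
      also have "\<dots> < e / 2 + C * (e / (2 * C))"
        using \<eta>' N[OF that] C by (intro add_le_less_mono mult_strict_left_mono) auto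
      also have "\<dots> = e" using C by simp
      finally show ?thesis .
    qed
    then show ?thesis by blast
  qed
  then obtain r where r: "strict_mono r" and ae: "AE x in M. Cauchy (\<lambda>i. s (r i) x)"
    by (rule cauchy_L1_AE_cauchy_subseq[OF int1])
  define l where "l x = lim (\<lambda>i. s (r i) x)" for x
  have [measurable]: "l \<in> borel_measurable M"
    unfolding l_def by (intro borel_measurable_lim_metric) auto
  have lim: "AE x in M. (\<lambda>i. s (r i) x) \<longlonglongrightarrow> l x"
    using ae by (rule eventually_mono) (simp add: l_def Cauchy_convergent_iff convergent_LIMSEQ_iff)
  have "\<exists>N. \<forall>i\<ge>N. integrable M (\<lambda>x. \<bar>s i x - l x\<bar> powr q) \<and> (LINT x|M. \<bar>s i x - l x\<bar> powr q) \<le> e"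
    if e: "0 < e" for e
  proof -
    obtain N where N: "\<And>i j. i \<ge> N \<Longrightarrow> j \<ge> N \<Longrightarrow> (LINT x|M. \<bar>s i x - s j x\<bar> powr q) < e"
      using Cauchy[OF e] by auto
    have "integrable M (\<lambda>x. \<bar>s i x - l x\<bar> powr q) \<and> (LINT x|M. \<bar>s i x - l x\<bar> powr q) \<le> e"
      if i: "i \<ge> N" for i
    proof -
      have "(\<integral>\<^sup>+x. ennreal (\<bar>s i x - l x\<bar> powr q) \<partial>M)
          = (\<integral>\<^sup>+x. liminf (\<lambda>k. ennreal (\<bar>s i x - s (r k) x\<bar> powr q)) \<partial>M)"
      proof (rule nn_integral_cong_AE)
        show "AE x in M. ennreal (\<bar>s i x - l x\<bar> powr q) = liminf (\<lambda>k. ennreal (\<bar>s i x - s (r k) x\<bar> powr q))"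
          using lim
        proof eventually_elim
          case (elim x)
          have "(\<lambda>k. ennreal (\<bar>s i x - s (r k) x\<bar> powr q)) \<longlonglongrightarrow> ennreal (\<bar>s i x - l x\<bar> powr q)"
            using q by (intro tendsto_ennrealI tendsto_powr2 tendsto_intros elim) auto
          then show ?case by (intro lim_imp_Liminf[symmetric]) auto
        qed
      qed
      also have "\<dots> \<le> liminf (\<lambda>k. \<integral>\<^sup>+x. ennreal (\<bar>s i x - s (r k) x\<bar> powr q) \<partial>M)"
        by (rule nn_integral_liminf) auto
      also have "\<dots> \<le> limsup (\<lambda>k. \<integral>\<^sup>+x. ennreal (\<bar>s i x - s (r k) x\<bar> powr q) \<partial>M)"
        by (rule Liminf_le_Limsup) auto
      also have "\<dots> \<le> ennreal e"
      proof (rule Limsup_bounded)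
        show "eventually (\<lambda>k. (\<integral>\<^sup>+x. ennreal (\<bar>s i x - s (r k) x\<bar> powr q) \<partial>M) \<le> ennreal e) sequentially"
        proof (rule eventually_sequentiallyI[of N])
          fix k assume "N \<le> k"
          then have "r k \<ge> N" using seq_suble[OF r, of k] by simp
          then show "(\<integral>\<^sup>+x. ennreal (\<bar>s i x - s (r k) x\<bar> powr q) \<partial>M) \<le> ennreal e"
            using N[OF i, of "r k"] int[of i "r k"]
            by (subst nn_integral_eq_integral) (auto intro!: ennreal_leI)
        qed
      qed
      finally have le: "(\<integral>\<^sup>+x. ennreal (\<bar>s i x - l x\<bar> powr q) \<partial>M) \<le> ennreal e" .
      then have ii: "integrable M (\<lambda>x. \<bar>s i x - l x\<bar> powr q)"
        by (intro integrableI_nonneg) (auto simp: less_top[symmetric] top_unique)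
      with le have "ennreal (LINT x|M. \<bar>s i x - l x\<bar> powr q) \<le> ennreal e"
        by (simp add: nn_integral_eq_integral)
      then show ?thesis using ii e by simp
    qed
    then show ?thesis by blast
  qed
  then show thesis by (intro that[of l]) auto
qed

lemma L0_rep: "\<exists>f. f \<in> borel_measurable leb01 \<and> abs_L0 f = x"
  using L0.abs_induct[of "\<lambda>x. \<exists>f. f \<in> borel_measurable leb01 \<and> abs_L0 f = x" x] by auto

lemma Lp_complete:
  assumes q: "1 \<le> q" and mem: "\<And>n::nat. Lp_mem q (s n)"
    and Cauchy: "\<And>e. 0 < e \<Longrightarrow> \<exists>N. \<forall>i\<ge>N. \<forall>j\<ge>N. Lp_norm q (s i - s j) < e"
  obtains l where "Lp_mem q l" "\<And>e. 0 < e \<Longrightarrow> \<exists>N. \<forall>i\<ge>N. Lp_norm q (s i - l) \<le> e"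
proof -
  have q0: "0 < q" "0 \<le> q" using q by auto
  obtain f where f [measurable]: "\<And>n. f n \<in> borel_measurable leb01" and s: "\<And>n. abs_L0 (f n) = s n"
    using choice[of "\<lambda>n f. f \<in> borel_measurable leb01 \<and> abs_L0 f = s n"] L0_rep by auto
  have diff: "abs_L0 g - abs_L0 h = abs_L0 (\<lambda>x. g x - h x)"
    if "g \<in> borel_measurable leb01" "h \<in> borel_measurable leb01" for g h
    using that by (intro minus_L0.abs_eq) auto
  have mem_eq: "Lp_mem p (abs_L0 g) = integrable leb01 (\<lambda>x. \<bar>g x\<bar> powr p)"
    if "g \<in> borel_measurable leb01" for g p
    using that by (intro Lp_mem.abs_eq) auto
  have int_eq: "Lp_integral p (abs_L0 g) = (LINT x|leb01. \<bar>g x\<bar> powr p)"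
    if "g \<in> borel_measurable leb01" for g p
    using that by (intro Lp_integral.abs_eq) auto
  have sdiff: "s i - s j = abs_L0 (\<lambda>x. f i x - f j x)" for i j
    by (simp add: s[symmetric] diff)
  obtain l where l [measurable]: "l \<in> borel_measurable leb01" and
    lim: "\<And>e. 0 < e \<Longrightarrow> \<exists>N. \<forall>i\<ge>N. integrable leb01 (\<lambda>x. \<bar>f i x - l x\<bar> powr q) \<and> (LINT x|leb01. \<bar>f i x - l x\<bar> powr q) \<le> e"
  proof (rule leb01.Lp_Cauchy_converges[OF q, of f])
    show "integrable leb01 (f i)" for i
    proof -
      have "Lp_mem 1 (s i)" using Lp_mem_mono[OF _ q mem] by simp
      then have "integrable leb01 (\<lambda>x. \<bar>f i x\<bar>)" by (simp add: s[symmetric] mem_eq)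
      then show ?thesis using integrable_abs_iff[OF f] by blast
    qed
    show "integrable leb01 (\<lambda>x. \<bar>f i x - f j x\<bar> powr q)" for i j
      using Lp_mem_diff[OF q0(2) mem[of i] mem[of j]] by (simp add: sdiff mem_eq)
    show "\<exists>N. \<forall>i\<ge>N. \<forall>j\<ge>N. (LINT x|leb01. \<bar>f i x - f j x\<bar> powr q) < e" if e: "0 < e" for e
    proof -
      obtain N where N: "\<And>i j. i \<ge> N \<Longrightarrow> j \<ge> N \<Longrightarrow> Lp_norm q (s i - s j) < e powr (1 / q)"
        using Cauchy[of "e powr (1 / q)"] e by auto
      have "(LINT x|leb01. \<bar>f i x - f j x\<bar> powr q) < e" if ij: "i \<ge> N" "j \<ge> N" for i j
      proof -
        have "(LINT x|leb01. \<bar>f i x - f j x\<bar> powr q) = Lp_norm q (s i - s j) powr q"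
          using Lp_integral_eq[OF q0(1), of "s i - s j"] by (simp add: sdiff int_eq)
        also have "\<dots> < (e powr (1 / q)) powr q"
          using q0 N[OF ij] by (intro powr_less_mono2) auto
        finally show ?thesis using q0 e by (simp add: powr_powr)
      qed
      then show ?thesis by blast
    qed
  qed (auto)
  have ldiff: "s i - abs_L0 l = abs_L0 (\<lambda>x. f i x - l x)" for i
    by (simp add: s[symmetric] diff)
  \<comment> \<open>A single difference s N - l in L_q suffices for l to lie in L_q, since s N
    does.\<close>
  obtain N where "integrable leb01 (\<lambda>x. \<bar>f N x - l x\<bar> powr q)" using lim[of 1] by auto
  then have "Lp_mem q (s N - abs_L0 l)" by (simp add: ldiff mem_eq)
  then have "Lp_mem q (s N - (s N - abs_L0 l))" by (rule Lp_mem_diff[OF q0(2) mem])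
  then have "Lp_mem q (abs_L0 l)" by simp
  moreover have "\<exists>N. \<forall>i\<ge>N. Lp_norm q (s i - abs_L0 l) \<le> e" if "0 < e" for e
    using lim[of "e powr q"] that Lp_integral_le_iff[OF q0(1), of e]
    by (simp add: ldiff int_eq[symmetric]) blast
  ultimately show thesis by (rule that)
qed

subsection \<open>Operators between \<open>L\<^sub>p\<close> spaces\<close>

lemma cut_scaleR: "cut A (c *\<^sub>R f) = c *\<^sub>R cut A f"
proof (transfer fixing: A c)
  fix f :: "real \<Rightarrow> real"
  assume "f \<in> borel_measurable leb01 \<and> f \<in> borel_measurable leb01 \<and> (AE x in leb01. f x = f x)"
  then show "(\<lambda>x. if A \<in> sets leb01 then indicator A x * (c * f x) else 0) \<in> borel_measurable leb01 \<and>
      (\<lambda>x. c * (if A \<in> sets leb01 then indicator A x * f x else 0)) \<in> borel_measurable leb01 \<and>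
      (AE x in leb01. (if A \<in> sets leb01 then indicator A x * (c * f x) else 0)
        = c * (if A \<in> sets leb01 then indicator A x * f x else 0))"
    by (cases "A \<in> sets leb01") auto
qed

lemma cut_minus: "cut A (- f) = - cut A f"
  using cut_scaleR[of A "-1" f] by simp

section \<open>L_q as a complete metric space; compactness as total boundedness\<close>

lemma Metric_space_Lp:
  assumes "1 \<le> q"
  shows "Metric_space {f. Lp_mem q f} (\<lambda>x y. Lp_norm q (x - y))"
proof
  fix x y z assume m: "x \<in> {f. Lp_mem q f}" "y \<in> {f. Lp_mem q f}"
  show "Lp_norm q (x - y) = 0 \<longleftrightarrow> x = y"
    using Lp_norm_eq_0[of q "x - y"] Lp_mem_diff[of q x y] m assms by auto
  assume z: "z \<in> {f. Lp_mem q f}"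
  show "Lp_norm q (x - z) \<le> Lp_norm q (x - y) + Lp_norm q (y - z)"
    using Lp_norm_triangle[OF assms, of "x - y" "y - z"] Lp_mem_diff[of q] m z assms by auto
qed (auto simp: Lp_norm_commute)

lemma mcomplete_Lp:
  assumes "1 \<le> q"
  shows "Metric_space.mcomplete {f. Lp_mem q f} (\<lambda>x y. Lp_norm q (x - y))"
proof -
  interpret Metric_space "{f. Lp_mem q f}" "\<lambda>x y. Lp_norm q (x - y)"
    by (rule Metric_space_Lp[OF assms])
  show ?thesis
    unfolding mcomplete_def
  proof (intro allI impI)
    fix s :: "nat \<Rightarrow> L0" assume C: "MCauchy s"
    have mem: "Lp_mem q (s n)" for n using C by (auto simp: MCauchy_def)
    have C': "\<exists>N. \<forall>i\<ge>N. \<forall>j\<ge>N. Lp_norm q (s i - s j) < e" if e: "0 < e" for e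
    proof -
      obtain N where "\<forall>i j. N \<le> i \<longrightarrow> N \<le> j \<longrightarrow> Lp_norm q (s i - s j) < e"
        using C e by (auto simp: MCauchy_def)
      then show ?thesis by (intro exI[of _ N]) simp
    qed
    obtain l where l: "Lp_mem q l" and lim: "\<And>e. 0 < e \<Longrightarrow> \<exists>N. \<forall>i\<ge>N. Lp_norm q (s i - l) \<le> e"
      using Lp_complete[OF assms mem C'] by blast
    have "limitin mtopology s l sequentially"
      unfolding limit_metric_sequentially
    proof (intro conjI allI impI)
      fix e :: real assume e: "0 < e"
      obtain N where N: "\<forall>i\<ge>N. Lp_norm q (s i - l) \<le> e / 2" using lim[of "e / 2"] e by auto
      show "\<exists>N. \<forall>n\<ge>N. s n \<in> {f. Lp_mem q f} \<and> Lp_norm q (s n - l) < e"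
      proof (intro exI allI impI conjI)
        fix n assume "N \<le> n"
        then have "Lp_norm q (s n - l) \<le> e / 2" using N by simp
        then show "Lp_norm q (s n - l) < e" using e by linarith
      qed (use mem in simp)
    qed (use l in auto)
    then show "\<exists>x. limitin mtopology s x sequentially" by blast
  qed
qed

text \<open>The centres are taken from S itself. When S is the image of a ball, each centre then has
  a preimage in that ball, which the equi-integrability argument relies on.\<close>

definition Lp_totally_bounded :: "real \<Rightarrow> L0 set \<Rightarrow> bool" where
  "Lp_totally_bounded q S \<longleftrightarrow>
     (\<forall>\<epsilon>>0. \<exists>K. finite K \<and> K \<subseteq> S \<and> (\<forall>x\<in>S. \<exists>k\<in>K. Lp_norm q (k - x) < \<epsilon>))"

text \<open>Centres anywhere in L_q are enough: moving each to a nearby point of S at most doubles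
  the radius.\<close>

lemma Lp_totally_boundedI:
  assumes "1 \<le> q" "\<And>x. x \<in> S \<Longrightarrow> Lp_mem q x"
    and net: "\<And>\<epsilon>. 0 < \<epsilon> \<Longrightarrow> \<exists>K. finite K \<and> (\<forall>k\<in>K. Lp_mem q k) \<and> (\<forall>x\<in>S. \<exists>k\<in>K. Lp_norm q (k - x) < \<epsilon>)"
  shows "Lp_totally_bounded q S"
  unfolding Lp_totally_bounded_def
proof (intro allI impI)
  fix \<epsilon> :: real assume "0 < \<epsilon>"
  interpret Metric_space "{f. Lp_mem q f}" "\<lambda>x y. Lp_norm q (x - y)"
    by (rule Metric_space_Lp[OF assms(1)])
  obtain K where K: "finite K" "\<And>k. k \<in> K \<Longrightarrow> Lp_mem q k" "\<And>x. x \<in> S \<Longrightarrow> \<exists>k\<in>K. Lp_norm q (k - x) < \<epsilon> / 2"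
    using net[of "\<epsilon> / 2"] \<open>0 < \<epsilon>\<close> by auto
  define near where "near k = (SOME y. y \<in> S \<and> Lp_norm q (k - y) < \<epsilon> / 2)" for k
  \<comment> \<open>Only centres that have a point of S within \<epsilon>/2 can be moved; the others
    cover nothing.\<close>
  define K' where "K' = {k \<in> K. \<exists>y\<in>S. Lp_norm q (k - y) < \<epsilon> / 2}"
  have near: "near k \<in> S \<and> Lp_norm q (k - near k) < \<epsilon> / 2" if "k \<in> K'" for k
    unfolding near_def by (rule someI_ex) (use that in \<open>auto simp: K'_def\<close>)
  have "\<exists>k\<in>near ` K'. Lp_norm q (k - x) < \<epsilon>" if x: "x \<in> S" for x
  proof -
    obtain k where k: "k \<in> K" "Lp_norm q (k - x) < \<epsilon> / 2" using K(3)[OF x] by auto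
    then have k': "k \<in> K'" using x by (auto simp: K'_def)
    have "Lp_norm q (near k - x) \<le> Lp_norm q (near k - k) + Lp_norm q (k - x)"
      using near[OF k'] assms(2) K(2)[OF k(1)] x by (intro triangle) auto
    also have "\<dots> < \<epsilon>" using near[OF k'] k by (simp add: Lp_norm_commute[of q "near k"])
    finally show ?thesis using k' by blast
  qed
  moreover have "finite (near ` K')" "near ` K' \<subseteq> S" using K(1) near by (auto simp: K'_def)
  ultimately show "\<exists>K. finite K \<and> K \<subseteq> S \<and> (\<forall>x\<in>S. \<exists>k\<in>K. Lp_norm q (k - x) < \<epsilon>)" by blast
qed

text \<open>Completeness of L_q makes total boundedness of a subset equivalent to compactness of its
  closure.\<close>

lemma compact_operator_Lp_iff:
  assumes q: "1 \<le> q"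
  shows "compact_operator (Lp p) (Lp q) R \<longleftrightarrow> bounded_operator (Lp p) (Lp q) R \<and>
    Lp_totally_bounded q (R ` {x. Lp_mem p x \<and> Lp_norm p x \<le> 1})"
proof (cases "bounded_operator (Lp p) (Lp q) R")
  case True
  interpret Metric_space "{f. Lp_mem q f}" "\<lambda>x y. Lp_norm q (x - y)"
    by (rule Metric_space_Lp[OF q])
  let ?S = "R ` {x. Lp_mem p x \<and> Lp_norm p x \<le> 1}"
  have S: "?S \<subseteq> {f. Lp_mem q f}" using True by (auto simp: bounded_operator_def Lp_def)
  have "compactin mtopology (mtopology closure_of ?S) \<longleftrightarrow> mtotally_bounded ?S"
    using mtotally_bounded_eq_compact_closure_of[OF mcomplete_Lp[OF q]] S by blast
  also have "\<dots> \<longleftrightarrow> Lp_totally_bounded q ?S"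
  proof -
    have "K \<subseteq> T \<and> T \<subseteq> (\<Union>x\<in>K. mball x \<epsilon>) \<longleftrightarrow> K \<subseteq> T \<and> (\<forall>x\<in>T. \<exists>k\<in>K. Lp_norm q (k - x) < \<epsilon>)"
      if T: "T \<subseteq> {f. Lp_mem q f}" for K T \<epsilon>
    proof (intro conj_cong refl)
      assume K: "K \<subseteq> T"
      have "x \<in> (\<Union>x\<in>K. mball x \<epsilon>) \<longleftrightarrow> (\<exists>k\<in>K. Lp_norm q (k - x) < \<epsilon>)" if "x \<in> T" for x
        using that K T by (auto simp: in_mball)
      then show "T \<subseteq> (\<Union>x\<in>K. mball x \<epsilon>) \<longleftrightarrow> (\<forall>x\<in>T. \<exists>k\<in>K. Lp_norm q (k - x) < \<epsilon>)"
        by blast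
    qed
    from this[OF S] show ?thesis unfolding mtotally_bounded_def Lp_totally_bounded_def by (simp only:)
  qed
  finally show ?thesis using True
    by (simp add: compact_operator_def ntopology_def Lp_def)
qed (simp add: compact_operator_def)

section \<open>Perturbation of near-maximisers\<close>

locale Lp_operator =
  fixes p q :: real and R :: "L0 \<Rightarrow> L0"
  assumes p: "1 < p" and q: "1 < q" and bounded_operator: "bounded_operator (Lp p) (Lp q) R"
begin

lemma mem: "Lp_mem p x \<Longrightarrow> Lp_mem q (R x)"
  and add: "Lp_mem p x \<Longrightarrow> Lp_mem p y \<Longrightarrow> R (x + y) = R x + R y"
  and scaleR: "Lp_mem p x \<Longrightarrow> R (c *\<^sub>R x) = c *\<^sub>R R x"
  using bounded_operator by (auto simp: bounded_operator_def Lp_def)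

lemma p0: "0 < p" using p by simp

lemma diff: "Lp_mem p x \<Longrightarrow> Lp_mem p y \<Longrightarrow> R (x - y) = R x - R y"
  using add[of x "- y"] scaleR[of y "-1"] Lp_mem_minus[of p y] by simp

lemma norm_bound: obtains C where "0 < C" "\<And>x. Lp_mem p x \<Longrightarrow> Lp_norm q (R x) \<le> C * Lp_norm p x"
proof -
  obtain C where C: "\<And>x. Lp_mem p x \<Longrightarrow> Lp_norm q (R x) \<le> C * Lp_norm p x"
    using bounded_operator by (auto simp: bounded_operator_def Lp_def)
  show thesis
  proof (rule that[of "max C 1"])
    fix x assume "Lp_mem p x"
    show "Lp_norm q (R x) \<le> max C 1 * Lp_norm p x"
      by (rule order.trans[OF C[OF \<open>Lp_mem p x\<close>]]) (intro mult_right_mono, auto)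
  qed simp
qed

text \<open>With y = |u|_p^p, boundedness of R gives |Ru|_q^q <= C^q y^(q/p), which is sublinear in
  y, so the functional has a finite supremum. The supremum need not be attained; hence the slack
  \<open>g\<close>.\<close>

lemma ex_almost_maximal:
  assumes "q < p" "0 < \<mu>" "0 < g"
  obtains u where "Lp_mem p u"
    "\<And>v. Lp_mem p v \<Longrightarrow> Lp_integral q (R v) - \<mu> * Lp_integral p v < Lp_integral q (R u) - \<mu> * Lp_integral p u + g"
proof -
  define \<Phi> where "\<Phi> u = Lp_integral q (R u) - \<mu> * Lp_integral p u" for u
  obtain C where C: "0 < C" "\<And>x. Lp_mem p x \<Longrightarrow> Lp_norm q (R x) \<le> C * Lp_norm p x"
    using norm_bound by blast
  obtain B where B: "\<And>y. 0 \<le> y \<Longrightarrow> C powr q * y powr (q / p) - \<mu> * y \<le> B"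
    using bdd_above_powr_minus_linear[of "C powr q" "q / p" \<mu>] assms p q by auto
  have "\<Phi> u \<le> B" if u: "Lp_mem p u" for u
  proof -
    have "Lp_integral q (R u) \<le> (C * Lp_norm p u) powr q"
      using C u q by (subst Lp_integral_le_iff) auto
    also have "\<dots> = C powr q * Lp_integral p u powr (q / p)"
      using C(1) p by (simp add: Lp_integral_eq powr_mult powr_powr)
    finally show ?thesis using B[of "Lp_integral p u"] by (simp add: \<Phi>_def)
  qed
  then have bdd: "bdd_above (\<Phi> ` {u. Lp_mem p u})" by (auto simp: bdd_above_def)
  have ne: "\<Phi> ` {u. Lp_mem p u} \<noteq> {}" using Lp_mem_zero[of p] by blast
  obtain u where u: "Lp_mem p u" "Sup (\<Phi> ` {u. Lp_mem p u}) - g < \<Phi> u"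
    using less_cSupD[OF ne, of "Sup (\<Phi> ` {u. Lp_mem p u}) - g"] assms(3) by auto
  have "\<Phi> v < \<Phi> u + g" if "Lp_mem p v" for v
    using cSup_upper[OF imageI bdd, of v] that u(2) by auto
  then show thesis using that u(1) by (auto simp: \<Phi>_def)
qed

lemma small_on_small_supports:
  assumes "2 \<le> q" "q < p" "0 < \<delta>"
  shows "\<exists>t>0. \<forall>A\<in>sets leb01. \<forall>x. measure leb01 A \<le> t \<longrightarrow> Lp_mem p x \<longrightarrow> Lp_norm p x \<le> 1 \<longrightarrow>
    Lp_integral q (R (cut A x)) \<le> \<delta>"
proof (rule ccontr)
  assume contr: "\<not> ?thesis"
  \<comment> \<open>Passing to u + v or u - v costs at most \<mu> 2^p (1 + 1) = \<delta>/2, the two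
    units being the mass of u on A and that of x. With the slack \<delta>/2 this leaves no room for
    a gain above \<delta>.\<close>
  define \<mu> where "\<mu> = \<delta> / (4 * 2 powr p)"
  have \<mu>: "0 < \<mu>" "\<mu> * 2 powr p = \<delta> / 4" using assms by (auto simp: \<mu>_def)
  obtain u where u: "Lp_mem p u" and max: "\<And>v. Lp_mem p v \<Longrightarrow>
      Lp_integral q (R v) - \<mu> * Lp_integral p v < Lp_integral q (R u) - \<mu> * Lp_integral p u + \<delta> / 2"
    using ex_almost_maximal[OF assms(2) \<mu>(1), of "\<delta> / 2"] assms(3) by auto
  \<comment> \<open>t depends on u only and is fixed before A and x appear, which makes the
    conclusion uniform.\<close>
  obtain t where t: "0 < t" "\<And>A. A \<in> sets leb01 \<Longrightarrow> measure leb01 A \<le> t \<Longrightarrow> Lp_integral p (cut A u) \<le> 1"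
    using Lp_integral_absolutely_continuous[of 1 p u] u by auto
  obtain A x where A: "A \<in> sets leb01" "measure leb01 A \<le> t" and x: "Lp_mem p x" "Lp_norm p x \<le> 1"
    and large: "\<delta> < Lp_integral q (R (cut A x))"
    using contr t(1) by (meson not_le)
  define v where "v = cut A x"
  have v: "Lp_mem p v" unfolding v_def by (rule Lp_mem_cut[OF x(1)])
  have uv: "Lp_mem p (u + v)" "Lp_mem p (u - v)" using Lp_mem_add[OF _ u v] Lp_mem_diff[OF _ u v] p by auto
  have x1: "Lp_integral p y \<le> 1" if "Lp_norm p y \<le> 1" for y
    using Lp_integral_le_iff[of p 1 y] that p by simp
  have grow: "Lp_integral p (u + cut A y) \<le> Lp_integral p u + 2 powr p * 2" if "Lp_mem p y" "Lp_norm p y \<le> 1" for y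
  proof -
    have "2 powr p * (Lp_integral p (cut A u) + Lp_integral p y) \<le> 2 powr p * 2"
      using t(2)[OF A] x1[OF that(2)] by (intro mult_left_mono) auto
    then show ?thesis
      using Lp_integral_add_cut_le[OF less_imp_le[OF p0] u that(1) A(1)] by linarith
  qed
  have "\<mu> * Lp_integral p (u + v) \<le> \<mu> * (Lp_integral p u + 2 powr p * 2)"
    "\<mu> * Lp_integral p (u - v) \<le> \<mu> * (Lp_integral p u + 2 powr p * 2)"
    using grow[of x] grow[of "- x"] x \<mu> by (auto simp: v_def cut_minus Lp_norm_minus Lp_mem_minus)
  moreover have "Lp_integral q (R u) + Lp_integral q (R v) \<le> (Lp_integral q (R (u + v)) + Lp_integral q (R (u - v))) / 2"
    using Lp_integral_clarkson_ge2[OF assms(1) mem[OF u] mem[OF v]] by (simp add: add diff u v)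
  moreover have "\<mu> * (Lp_integral p u + 2 powr p * 2) = \<mu> * Lp_integral p u + \<delta> / 2"
    using \<mu>(2) by (simp add: algebra_simps)
  ultimately show False
    using max[OF uv(1)] max[OF uv(2)] large unfolding v_def[symmetric] by argo
qed

lemma equi_integrable_range:
  assumes "p \<le> 2" "q < p" "0 < \<delta>"
  shows "\<exists>t>0. \<forall>A\<in>sets leb01. \<forall>x. measure leb01 A \<le> t \<longrightarrow> Lp_mem p x \<longrightarrow> Lp_norm p x \<le> 1 \<longrightarrow>
    Lp_integral q (cut A (R x)) \<le> \<delta>"
proof (rule ccontr)
  assume contr: "\<not> ?thesis"
  \<comment> \<open>On average over the two signs the cost is at most \<mu> = \<delta>/4 by
    Clarkson's inequality in L_p. Together with the slack \<delta>/2 and the mass \<delta>/4 that Ru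
    may lose on A, this adds up to \<delta>.\<close>
  define \<mu> where "\<mu> = \<delta> / 4"
  have \<mu>: "0 < \<mu>" using assms by (auto simp: \<mu>_def)
  obtain u where u: "Lp_mem p u" and max: "\<And>v. Lp_mem p v \<Longrightarrow>
      Lp_integral q (R v) - \<mu> * Lp_integral p v < Lp_integral q (R u) - \<mu> * Lp_integral p u + \<delta> / 2"
    using ex_almost_maximal[OF assms(2) \<mu>(1), of "\<delta> / 2"] assms(3) by auto
  obtain t where t: "0 < t" "\<And>A. A \<in> sets leb01 \<Longrightarrow> measure leb01 A \<le> t \<Longrightarrow> Lp_integral q (cut A (R u)) \<le> \<delta> / 4"
    using Lp_integral_absolutely_continuous[of "\<delta> / 4" q "R u"] mem[OF u] assms(3) by auto
  obtain A x where A: "A \<in> sets leb01" "measure leb01 A \<le> t" and x: "Lp_mem p x" "Lp_norm p x \<le> 1"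
    and large: "\<delta> < Lp_integral q (cut A (R x))"
    using contr t(1) by (meson not_le)
  have ux: "Lp_mem p (u + x)" "Lp_mem p (u - x)" using Lp_mem_add[OF _ u x(1)] Lp_mem_diff[OF _ u x(1)] p by auto
  have x1: "Lp_integral p x \<le> 1" using Lp_integral_le_iff[of p 1 x] x p by simp
  have "(Lp_integral p (u + x) + Lp_integral p (u - x)) / 2 \<le> Lp_integral p u + 1"
    using Lp_integral_clarkson_le2[OF _ assms(1) u x(1)] x1 p by simp
  then have "\<mu> * ((Lp_integral p (u + x) + Lp_integral p (u - x)) / 2) \<le> \<mu> * (Lp_integral p u + 1)"
    using \<mu> by (intro mult_left_mono) auto
  then have "\<mu> * Lp_integral p (u + x) + \<mu> * Lp_integral p (u - x) \<le> 2 * (\<mu> * Lp_integral p u) + \<delta> / 2"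
    by (simp add: algebra_simps \<mu>_def)
  moreover
  have "Lp_integral q (R u) - Lp_integral q (cut A (R u)) + Lp_integral q (cut A (R x))
      \<le> (Lp_integral q (R (u + x)) + Lp_integral q (R (u - x))) / 2"
    using Lp_integral_jensen_cut[OF _ mem[OF u] mem[OF x(1)] A(1)] q by (simp add: add diff u x)
  then have "2 * Lp_integral q (R u) + 3 / 2 * \<delta> < Lp_integral q (R (u + x)) + Lp_integral q (R (u - x))"
    using large t(2)[OF A] by argo
  ultimately show False
    using max[OF ux(1)] max[OF ux(2)] by argo
qed

end

section \<open>Closed subspaces, truncation and density of L_inf\<close>

lemma closedin_Lp_iff:
  assumes "1 \<le> q"
  shows "closedin (ntopology (Lp q)) Z \<longleftrightarrow> Z \<subseteq> {f. Lp_mem q f} \<and>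
    (\<forall>(s :: nat \<Rightarrow> L0) l. range s \<subseteq> Z \<and> Lp_mem q l \<and> (\<forall>e>0. \<exists>N. \<forall>n\<ge>N. Lp_norm q (s n - l) < e) \<longrightarrow> l \<in> Z)"
proof -
  interpret Metric_space "{f. Lp_mem q f}" "\<lambda>x y. Lp_norm q (x - y)"
    by (rule Metric_space_Lp[OF assms])
  have lim: "limitin mtopology s l sequentially \<longleftrightarrow>
      Lp_mem q l \<and> (\<forall>e>0. \<exists>N. \<forall>n\<ge>N. Lp_norm q (s n - l) < e)"
    if "Z \<subseteq> {f. Lp_mem q f}" "range s \<subseteq> Z" for s :: "nat \<Rightarrow> L0" and l
  proof -
    have "Lp_mem q (s n)" for n using that by blast
    then show ?thesis unfolding limit_metric_sequentially by simp
  qed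
  have top: "ntopology (Lp q) = mtopology" by (simp add: ntopology_def Lp_def)
  show ?thesis
    unfolding top metric_closedin_iff_sequentially_closed
  proof (intro conj_cong refl)
    assume Z: "Z \<subseteq> {f. Lp_mem q f}"
    have "range s \<subseteq> Z \<and> limitin mtopology s l sequentially \<longleftrightarrow>
        range s \<subseteq> Z \<and> Lp_mem q l \<and> (\<forall>e>0. \<exists>N. \<forall>n\<ge>N. Lp_norm q (s n - l) < e)" for s :: "nat \<Rightarrow> L0" and l
      using lim[OF Z, of s l] by blast
    then show "(\<forall>s l. range s \<subseteq> Z \<and> limitin mtopology s l sequentially \<longrightarrow> l \<in> Z) \<longleftrightarrow>
      (\<forall>(s :: nat \<Rightarrow> L0) l. range s \<subseteq> Z \<and> Lp_mem q l \<and> (\<forall>e>0. \<exists>N. \<forall>n\<ge>N. Lp_norm q (s n - l) < e) \<longrightarrow> l \<in> Z)"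
      by (simp only:)
  qed
qed

lemma ex_truncation_level:
  assumes "0 < p" "0 < t" "0 \<le> c"
  obtains m where "0 < m" "\<And>x. Lp_mem p x \<Longrightarrow> Lp_integral p x \<le> c \<Longrightarrow>
    \<exists>A\<in>sets leb01. measure leb01 A \<le> t \<and> L0_esssup (x - cut A x) \<le> ereal m"
proof -
  \<comment> \<open>Chebyshev's inequality requires m^p >= c / t; replacing c by c + 1 keeps m
    positive when c = 0.\<close>
  define m where "m = ((c + 1) / t) powr (1 / p)"
  have m: "0 < m" "m powr p = (c + 1) / t" using assms by (auto simp: m_def powr_powr)
  have "\<exists>A\<in>sets leb01. measure leb01 A \<le> t \<and> L0_esssup (x - cut A x) \<le> ereal m"
    if x: "Lp_mem p x" "Lp_integral p x \<le> c" for x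
  proof -
    obtain A where A: "A \<in> sets leb01" "measure leb01 A * m powr p \<le> Lp_integral p x"
      "L0_esssup (x - cut A x) \<le> ereal m"
      using ex_cut_esssup_le[OF assms(1) m(1) x(1)] by blast
    have "measure leb01 A * ((c + 1) / t) \<le> t * ((c + 1) / t)" using A(2) x(2) m(2) assms(2) by simp
    moreover have "0 < (c + 1) / t" using assms by simp
    ultimately have "measure leb01 A \<le> t" by (rule mult_right_le_imp_le)
    then show ?thesis using A by blast
  qed
  with m(1) show thesis by (rule that)
qed

lemma Linf_mem: "L0_esssup f \<le> ereal m \<Longrightarrow> f \<in> vecs Linf"
  by (auto simp: Linf_def intro: le_less_trans)

text \<open>Truncation at a high level removes x only on a set of small measure, where x has little
  mass by absolute continuity.\<close>

lemma Linf_dense_in_Lp: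
  assumes "0 < p" "Lp_mem p x" "0 < \<epsilon>"
  shows "\<exists>y\<in>vecs Linf. Lp_mem p y \<and> Lp_norm p (x - y) \<le> \<epsilon>"
proof -
  obtain t where t: "0 < t" "\<And>A. A \<in> sets leb01 \<Longrightarrow> measure leb01 A \<le> t \<Longrightarrow> Lp_integral p (cut A x) \<le> \<epsilon> powr p"
    using Lp_integral_absolutely_continuous[of "\<epsilon> powr p" p x] assms by auto
  obtain m where m: "0 < m" "\<And>y. Lp_mem p y \<Longrightarrow> Lp_integral p y \<le> Lp_integral p x \<Longrightarrow>
      \<exists>A\<in>sets leb01. measure leb01 A \<le> t \<and> L0_esssup (y - cut A y) \<le> ereal m"
    using ex_truncation_level[OF assms(1) t(1) Lp_integral_nonneg[of p x]] by blast
  obtain A where A: "A \<in> sets leb01" "measure leb01 A \<le> t" "L0_esssup (x - cut A x) \<le> ereal m"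
    using m(2)[OF assms(2)] by auto
  have "Lp_norm p (x - (x - cut A x)) \<le> \<epsilon>"
    using t(2)[OF A(1,2)] Lp_integral_le_iff[of p \<epsilon> "cut A x"] assms by simp
  moreover have "x - cut A x \<in> vecs Linf" by (rule Linf_mem[OF A(3)])
  moreover have "Lp_mem p (x - cut A x)" using Lp_bounded[OF assms(1) _ A(3)] m(1) by simp
  ultimately show ?thesis by blast
qed

section \<open>Lower estimates on subspaces, uniqueness of extensions, transfer of
  compactness\<close>

context Lp_operator
begin

text \<open>The target is the image of Z, so surjectivity is automatic; injectivity and boundedness
  of the inverse both amount to a lower estimate for R on Z.\<close>

lemma isomorphism_iff:
  assumes Z: "subspace Z" "Z \<subseteq> {f. Lp_mem p f}"
  shows "isomorphism (Lp p\<lparr>vecs := Z\<rparr>) (Lp q\<lparr>vecs := R ` Z\<rparr>) R \<longleftrightarrow>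
    (\<exists>C. \<forall>z\<in>Z. Lp_norm p z \<le> C * Lp_norm q (R z))"
proof
  assume iso: "isomorphism (Lp p\<lparr>vecs := Z\<rparr>) (Lp q\<lparr>vecs := R ` Z\<rparr>) R"
  then have inj: "inj_on R Z" by (auto simp: isomorphism_def bij_betw_def Lp_def)
  from iso obtain C where "\<forall>y\<in>R ` Z. Lp_norm p (inv_into Z R y) \<le> C * Lp_norm q y"
    by (auto simp: isomorphism_def bounded_operator_def Lp_def)
  then show "\<exists>C. \<forall>z\<in>Z. Lp_norm p z \<le> C * Lp_norm q (R z)"
    using inv_into_f_f[OF inj] by (intro exI[of _ C]) auto
next
  assume "\<exists>C. \<forall>z\<in>Z. Lp_norm p z \<le> C * Lp_norm q (R z)"
  then obtain C where C: "\<And>z. z \<in> Z \<Longrightarrow> Lp_norm p z \<le> C * Lp_norm q (R z)" by blast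
  have mem: "Lp_mem p z" if "z \<in> Z" for z using Z(2) that by blast
  have inj: "inj_on R Z"
  proof (rule inj_onI)
    fix x y assume xy: "x \<in> Z" "y \<in> Z" "R x = R y"
    have d: "x - y \<in> Z" using Z(1) xy by (simp add: subspace_diff)
    have "R (x - y) = 0" using diff[of x y] mem xy by simp
    then have "Lp_norm p (x - y) \<le> 0" using C[OF d] q by simp
    then have "Lp_norm p (x - y) = 0" using Lp_norm_nonneg[of p "x - y"] by linarith
    then show "x = y" using Lp_norm_eq_0[OF p0 mem[OF d]] by simp
  qed
  have inv: "inv_into Z R (R z) = z" if "z \<in> Z" for z by (rule inv_into_f_f[OF inj that])
  have inv_add: "inv_into Z R (R x + R y) = x + y" if "x \<in> Z" "y \<in> Z" for x y
    using inv[of "x + y"] that add[of x y] mem Z(1) by (simp add: subspace_add)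
  have inv_scaleR: "inv_into Z R (c *\<^sub>R R x) = c *\<^sub>R x" if "x \<in> Z" for x c
    using inv[of "c *\<^sub>R x"] that scaleR[of x c] mem Z(1) by (simp add: subspace_scale)
  obtain D where D: "\<And>x. Lp_mem p x \<Longrightarrow> Lp_norm q (R x) \<le> D * Lp_norm p x"
    using norm_bound by blast
  have "bounded_operator (Lp p\<lparr>vecs := Z\<rparr>) (Lp q\<lparr>vecs := R ` Z\<rparr>) R"
    using mem D by (auto simp: bounded_operator_def Lp_def add scaleR intro!: exI[of _ D])
  moreover have "bounded_operator (Lp q\<lparr>vecs := R ` Z\<rparr>) (Lp p\<lparr>vecs := Z\<rparr>) (inv_into Z R)"
    using C by (auto simp: bounded_operator_def Lp_def inv inv_add inv_scaleR intro!: exI[of _ C])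
  ultimately show "isomorphism (Lp p\<lparr>vecs := Z\<rparr>) (Lp q\<lparr>vecs := R ` Z\<rparr>) R"
    using inj by (simp add: isomorphism_def inj_on_imp_bij_betw Lp_def)
qed

text \<open>The contrapositive form, with the isomorphism replaced by a lower estimate: such an
  estimate is easily moved from one exponent to another.\<close>

lemma strictly_singular_iff:
  "strictly_singular (Lp p) (Lp q) R \<longleftrightarrow>
    (\<forall>Z. subspace Z \<and> closedin (ntopology (Lp p)) Z \<and> (\<exists>C. \<forall>z\<in>Z. Lp_norm p z \<le> C * Lp_norm q (R z))
      \<longrightarrow> (\<exists>B. finite B \<and> Z \<subseteq> span B))"
proof -
  have vecs: "vecs (Lp p) = {f. Lp_mem p f}" by (simp add: Lp_def)
  have "(subspace Z \<and> Z \<subseteq> vecs (Lp p) \<and> closedin (ntopology (Lp p)) Z \<and> \<not> (\<exists>B. finite B \<and> Z \<subseteq> span B) \<longrightarrow>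
      \<not> isomorphism (Lp p\<lparr>vecs := Z\<rparr>) (Lp q\<lparr>vecs := R ` Z\<rparr>) R) \<longleftrightarrow>
    (subspace Z \<and> closedin (ntopology (Lp p)) Z \<and> (\<exists>C. \<forall>z\<in>Z. Lp_norm p z \<le> C * Lp_norm q (R z))
      \<longrightarrow> (\<exists>B. finite B \<and> Z \<subseteq> span B))" for Z
  proof (cases "subspace Z \<and> closedin (ntopology (Lp p)) Z")
    case True
    then have "Z \<subseteq> {f. Lp_mem p f}" using closedin_Lp_iff[OF less_imp_le[OF p], of Z] by blast
    then show ?thesis using True isomorphism_iff[of Z] vecs by blast
  qed blast
  then show ?thesis using bounded_operator unfolding strictly_singular_def by simp
qed

text \<open>Through the inclusion of L_q in L_q' both operators are continuous from L_p to L_q', and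
  L_inf is dense in L_p.\<close>

lemma eq_if_eq_on_Linf:
  assumes "Lp_operator p q' R'" and agree: "\<And>f. f \<in> vecs Linf \<Longrightarrow> R f = R' f"
    and "q' \<le> q" and x: "Lp_mem p x"
  shows "R x = R' x"
proof -
  interpret R': Lp_operator p q' R' by fact
  define c where "c = 2 powr (1 / q')"
  have c: "0 < c" by (simp add: c_def)
  obtain C where C: "0 < C" "\<And>x. Lp_mem p x \<Longrightarrow> Lp_norm q (R x) \<le> C * Lp_norm p x" using norm_bound by blast
  obtain C' where C': "0 < C'" "\<And>x. Lp_mem p x \<Longrightarrow> Lp_norm q' (R' x) \<le> C' * Lp_norm p x" using R'.norm_bound by blast
  have q': "1 \<le> q'" "0 < q'" "0 \<le> q'" using R'.q by auto
  have memq': "Lp_mem q' (R y)" if "Lp_mem p y" for y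
    using Lp_mem_mono[OF q'(3) \<open>q' \<le> q\<close> mem[OF that]] .
  have "Lp_norm q' (R x - R' x) \<le> e" if e: "0 < e" for e
  proof -
    \<comment> \<open>The denominator bounds the norm of R - R' from L_p to L_q', c being the
      inclusion constant.\<close>
    define \<epsilon> where "\<epsilon> = e / (c * C + C')"
    have pos: "0 < c * C + C'" using c C C' by (simp add: add_pos_pos)
    then obtain y where y: "y \<in> vecs Linf" "Lp_mem p y" "Lp_norm p (x - y) \<le> \<epsilon>"
      using Linf_dense_in_Lp[OF p0 x, of \<epsilon>] e by (auto simp: \<epsilon>_def)
    have d: "Lp_mem p (x - y)" using Lp_mem_diff[OF _ x y(2)] p by simp
    have "R x - R' x = R (x - y) + - R' (x - y)"
      using agree[OF y(1)] by (simp add: diff R'.diff x y(2))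
    then have "Lp_norm q' (R x - R' x) \<le> Lp_norm q' (R (x - y)) + Lp_norm q' (R' (x - y))"
      using Lp_norm_triangle[OF q'(1) memq'[OF d], of "- R' (x - y)"] R'.mem[OF d]
      by (simp add: Lp_mem_minus Lp_norm_minus)
    also have "\<dots> \<le> c * (C * Lp_norm p (x - y)) + C' * Lp_norm p (x - y)"
    proof (intro add_mono C'(2) d)
      have "Lp_norm q' (R (x - y)) \<le> c * Lp_norm q (R (x - y))"
        unfolding c_def by (rule Lp_norm_mono_exponent[OF q'(2) \<open>q' \<le> q\<close> mem[OF d]])
      also have "\<dots> \<le> c * (C * Lp_norm p (x - y))"
        using c C(2)[OF d] by (intro mult_left_mono) auto
      finally show "Lp_norm q' (R (x - y)) \<le> c * (C * Lp_norm p (x - y))" .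
    qed
    also have "\<dots> = (c * C + C') * Lp_norm p (x - y)" by (simp add: algebra_simps)
    also have "\<dots> \<le> (c * C + C') * \<epsilon>" using pos y(3) by (intro mult_left_mono) auto
    also have "\<dots> = e" using pos by (simp add: \<epsilon>_def)
    finally show ?thesis .
  qed
  then have "Lp_norm q' (R x - R' x) \<le> 0" by (rule field_le_epsilon[of _ 0, simplified])
  then have "Lp_norm q' (R x - R' x) = 0" using Lp_norm_nonneg[of q' "R x - R' x"] by linarith
  then show ?thesis
    using Lp_norm_eq_0[OF q'(2) Lp_mem_diff[OF q'(3) memq'[OF x] R'.mem[OF x]]] by simp
qed

text \<open>Bounded functions mediate between the two domains: after truncation at height m, a unit
  vector of L_p becomes a vector of the m-ball of L_p' on which R and R' agree. The part cut off has
  small support, so its image is small.\<close>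

lemma compact_if_compact_on_Linf:
  assumes "2 \<le> q" "q < p" and "1 < p'"
    and compact: "compact_operator (Lp p') (Lp q) R'" and agree: "\<And>f. f \<in> vecs Linf \<Longrightarrow> R f = R' f"
  shows "compact_operator (Lp p) (Lp q) R"
proof -
  have q1: "1 \<le> q" "0 < q" using q by auto
  interpret R': Lp_operator p' q R'
    using compact assms(3) q by unfold_locales (simp_all add: compact_operator_def)
  have tb: "Lp_totally_bounded q (R' ` {x. Lp_mem p' x \<and> Lp_norm p' x \<le> 1})"
    using compact compact_operator_Lp_iff[OF q1(1)] by blast
  have "Lp_totally_bounded q (R ` {x. Lp_mem p x \<and> Lp_norm p x \<le> 1})"
  proof (rule Lp_totally_boundedI[OF q1(1)])
    fix \<epsilon> :: real assume \<epsilon>: "0 < \<epsilon>"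
    obtain t where t: "0 < t" "\<And>A x. A \<in> sets leb01 \<Longrightarrow> measure leb01 A \<le> t \<Longrightarrow> Lp_mem p x \<Longrightarrow> Lp_norm p x \<le> 1
        \<Longrightarrow> Lp_integral q (R (cut A x)) \<le> (\<epsilon> / 2) powr q"
      using small_on_small_supports[OF assms(1,2), of "(\<epsilon> / 2) powr q"] \<epsilon> by auto
    obtain m where m: "0 < m" "\<And>x. Lp_mem p x \<Longrightarrow> Lp_integral p x \<le> 1 \<Longrightarrow>
        \<exists>A\<in>sets leb01. measure leb01 A \<le> t \<and> L0_esssup (x - cut A x) \<le> ereal m"
      using ex_truncation_level[OF p0 t(1), of 1] by auto
    \<comment> \<open>The net is chosen for the unit ball of L_p' and stretched by m afterwards, so
      its mesh is divided by m in advance.\<close>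
    have "0 < \<epsilon> / (2 * m)" using \<epsilon> m by simp
    then obtain K where K: "finite K" "K \<subseteq> R' ` {x. Lp_mem p' x \<and> Lp_norm p' x \<le> 1}"
      "\<And>x. Lp_mem p' x \<Longrightarrow> Lp_norm p' x \<le> 1 \<Longrightarrow> \<exists>k\<in>K. Lp_norm q (k - R' x) < \<epsilon> / (2 * m)"
      using tb unfolding Lp_totally_bounded_def by (metis (mono_tags, lifting) imageI mem_Collect_eq)
    have Kmem: "Lp_mem q k" if "k \<in> K" for k using K(2) R'.mem that by blast
    have "\<exists>k\<in>(\<lambda>k. m *\<^sub>R k) ` K. Lp_norm q (k - R x) < \<epsilon>" if x: "Lp_mem p x" "Lp_norm p x \<le> 1" for x
    proof -
      obtain A where A: "A \<in> sets leb01" "measure leb01 A \<le> t" "L0_esssup (x - cut A x) \<le> ereal m"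
        using m(2)[OF x(1)] x(2) Lp_integral_le_iff[OF p0, of 1 x] by auto
      define y where "y = x - cut A x"
      have y: "Lp_mem p' y" "Lp_norm p' y \<le> m" "Lp_mem p y"
        using Lp_bounded[OF _ _ A(3)] Lp_integral_le_iff[OF R'.p0, of m y] R'.p0 p0 m(1) by (auto simp: y_def)
      have c: "Lp_mem p (cut A x)" by (rule Lp_mem_cut[OF x(1)])
      obtain k where k: "k \<in> K" "Lp_norm q (k - R' ((1 / m) *\<^sub>R y)) < \<epsilon> / (2 * m)"
        using K(3)[OF Lp_mem_scaleR[OF y(1)], of "1 / m"] y(2) m(1) R'.p0 by (auto simp: Lp_norm_scaleR)
      have Ry: "R y = R' y" using agree Linf_mem[OF A(3)] by (simp add: y_def)
      have "m *\<^sub>R k - R y = m *\<^sub>R (k - R' ((1 / m) *\<^sub>R y))"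
        using m(1) by (simp add: Ry R'.scaleR[OF y(1)] scaleR_diff_right)
      then have "Lp_norm q (m *\<^sub>R k - R y) = m * Lp_norm q (k - R' ((1 / m) *\<^sub>R y))"
        using m(1) by (simp add: Lp_norm_scaleR[OF q1(2)] del: scaleR_right_diff_distrib)
      also have "\<dots> < m * (\<epsilon> / (2 * m))" using m(1) k(2) by (rule mult_strict_left_mono[rotated])
      finally have 1: "Lp_norm q (m *\<^sub>R k - R y) < \<epsilon> / 2" using m(1) by simp
      have 2: "Lp_norm q (R (cut A x)) \<le> \<epsilon> / 2"
        using t(2)[OF A(1,2) x] Lp_integral_le_iff[OF q1(2), of "\<epsilon> / 2" "R (cut A x)"] \<epsilon> by simp
      have eq: "m *\<^sub>R k - R x = (m *\<^sub>R k - R y) + - R (cut A x)"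
        using diff[OF x(1) c] by (simp add: y_def)
      have "Lp_mem q (m *\<^sub>R k - R y)" "Lp_mem q (- R (cut A x))"
        using Lp_mem_diff[of q, OF _ Lp_mem_scaleR[OF Kmem[OF k(1)], of m] mem[OF y(3)]] q1
          Lp_mem_minus[OF mem[OF c]] by auto
      then have "Lp_norm q (m *\<^sub>R k - R x) \<le> Lp_norm q (m *\<^sub>R k - R y) + Lp_norm q (- R (cut A x))"
        unfolding eq by (rule Lp_norm_triangle[OF q1(1)])
      then have "Lp_norm q (m *\<^sub>R k - R x) < \<epsilon>" using 1 2 unfolding Lp_norm_minus by linarith
      then show ?thesis using k(1) by blast
    qed
    then show "\<exists>K. finite K \<and> (\<forall>k\<in>K. Lp_mem q k) \<and>
        (\<forall>x\<in>R ` {x. Lp_mem p x \<and> Lp_norm p x \<le> 1}. \<exists>k\<in>K. Lp_norm q (k - x) < \<epsilon>)"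
      using K(1) Kmem by (intro exI[of _ "(\<lambda>k. m *\<^sub>R k) ` K"]) (auto intro: Lp_mem_scaleR)
  qed (use mem in auto)
  then show ?thesis using compact_operator_Lp_iff[OF q1(1)] bounded_operator by blast
qed

text \<open>A net for the L_q' norm, fine enough, is already a net for the L_q norm: a difference h
  that is small in L_q' exceeds m only on a set of small measure, where equi-integrability controls
  it, and elsewhere it is bounded by m.\<close>

lemma compact_if_compact_to_larger_space:
  assumes "p \<le> 2" "q < p" and q': "1 < q'" "q' \<le> q"
    and compact: "compact_operator (Lp p) (Lp q') R'" and agree: "\<And>f. f \<in> vecs Linf \<Longrightarrow> R f = R' f"
  shows "compact_operator (Lp p) (Lp q) R"
proof -
  have q1: "1 \<le> q" "0 < q" "0 \<le> q" "1 \<le> q'" "0 < q'" "0 \<le> q'" using q q' by auto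
  have R': "Lp_operator p q' R'"
    using compact p q' by unfold_locales (simp_all add: compact_operator_def)
  have eq: "R x = R' x" if "Lp_mem p x" for x
    by (rule eq_if_eq_on_Linf[OF R' agree q'(2) that])
  let ?S = "R ` {x. Lp_mem p x \<and> Lp_norm p x \<le> 1}"
  have "?S = R' ` {x. Lp_mem p x \<and> Lp_norm p x \<le> 1}" using eq by (intro image_cong) auto
  then have tb: "Lp_totally_bounded q' ?S"
    using compact compact_operator_Lp_iff[OF q1(4)] by metis
  have S: "Lp_mem q k" if "k \<in> ?S" for k using mem that by blast
  have "Lp_totally_bounded q ?S"
  proof (rule Lp_totally_boundedI[OF q1(1) S])
    fix \<epsilon> :: real assume \<epsilon>: "0 < \<epsilon>"
    \<comment> \<open>The parts of h on A and off A may each contribute \<eta> to the modular, in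
      total (\<epsilon>/2)^q; aiming at \<epsilon>/2 turns the weak bound into a strict one below
      \<epsilon>.\<close>
    define \<eta> where "\<eta> = (\<epsilon> / 2) powr q / 2"
    have \<eta>: "0 < \<eta>" using \<epsilon> by (simp add: \<eta>_def)
    obtain t where t: "0 < t" "\<And>A x. A \<in> sets leb01 \<Longrightarrow> measure leb01 A \<le> t \<Longrightarrow> Lp_mem p x \<Longrightarrow> Lp_norm p x \<le> 1
        \<Longrightarrow> Lp_integral q (cut A (R x)) \<le> \<eta> / 2 powr q"
      using equi_integrable_range[OF assms(1,2), of "\<eta> / 2 powr q"] \<eta> by auto
    define m where "m = \<eta> powr (1 / q)"
    have m: "0 < m" "m powr q = \<eta>" using \<eta> q1 by (simp_all add: m_def powr_powr)
    \<comment> \<open>Chosen so that Chebyshev's inequality at height m, applied to a function of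
      L_q' norm at most r, gives a set of measure at most t.\<close>
    define r where "r = (t * m powr q') powr (1 / q')"
    have r: "0 < r" "r powr q' = t * m powr q'" using t(1) m(1) q1 by (simp_all add: r_def powr_powr)
    obtain K where K: "finite K" "K \<subseteq> ?S" "\<And>x. x \<in> ?S \<Longrightarrow> \<exists>k\<in>K. Lp_norm q' (k - x) < r"
      using tb[unfolded Lp_totally_bounded_def, rule_format, OF r(1)] by blast
    have "\<exists>k\<in>K. Lp_norm q (k - y) < \<epsilon>" if y: "y \<in> ?S" for y
    proof -
      obtain k where k: "k \<in> K" "Lp_norm q' (k - y) < r" using K(3)[OF y] by blast
      obtain x x' where x: "Lp_mem p x" "Lp_norm p x \<le> 1" "y = R x"
        and x': "Lp_mem p x'" "Lp_norm p x' \<le> 1" "k = R x'"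
        using y k(1) K(2) by blast
      define h where "h = k - y"
      \<comment> \<open>Halving brings the difference of two unit-ball vectors back into the unit
        ball, where equi-integrability is available. The resulting factor in h = 2 Rw is compensated
        by the 2^q in the choice of t.\<close>
      define w where "w = (1 / 2) *\<^sub>R (x' - x)"
      have d: "Lp_mem p (x' - x)" using Lp_mem_diff[OF _ x'(1) x(1)] p by simp
      have w: "Lp_mem p w" unfolding w_def by (rule Lp_mem_scaleR[OF d])
      have "Lp_norm p (x' - x) \<le> 2"
        using Lp_norm_triangle[of p x' "- x"] x x' p by (simp add: Lp_mem_minus Lp_norm_minus)
      then have w1: "Lp_norm p w \<le> 1" using p by (simp add: w_def Lp_norm_scaleR del: scaleR_half_double)
      have h: "h = 2 *\<^sub>R R w"
        unfolding h_def w_def scaleR[OF d] diff[OF x'(1) x(1)] x(3) x'(3) by simp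
      have hm: "Lp_mem q h" unfolding h by (rule Lp_mem_scaleR[OF mem[OF w]])
      have hm': "Lp_mem q' h" by (rule Lp_mem_mono[OF q1(6) q'(2) hm])
      obtain A where A: "A \<in> sets leb01" "measure leb01 A * m powr q' \<le> Lp_integral q' h"
        "L0_esssup (h - cut A h) \<le> ereal m"
        using ex_cut_esssup_le[OF q1(5) m(1) hm'] by blast
      have "Lp_integral q' h \<le> t * m powr q'"
        using Lp_integral_le_iff[OF q1(5), of r h] k(2) r by (simp add: h_def)
      then have "measure leb01 A * m powr q' \<le> t * m powr q'" using A(2) by simp
      then have At: "measure leb01 A \<le> t" using m(1) by simp
      have "cut A h = 2 *\<^sub>R cut A (R w)" unfolding h by (rule cut_scaleR)
      then have "Lp_integral q (cut A h) = 2 powr q * Lp_integral q (cut A (R w))"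
        by (simp add: Lp_integral_scaleR)
      also have "\<dots> \<le> 2 powr q * (\<eta> / 2 powr q)"
        using t(2)[OF A(1) At w w1] by (intro mult_left_mono) auto
      finally have "Lp_integral q (cut A h) \<le> \<eta>" by simp
      moreover have "Lp_integral q (h - cut A h) \<le> \<eta>"
        using Lp_bounded[OF q1(2) _ A(3)] m by simp
      ultimately have "Lp_integral q h \<le> 2 * \<eta>" using Lp_integral_split[OF q1(3) hm A(1)] by simp
      then have "Lp_norm q h \<le> \<epsilon> / 2"
        using Lp_integral_le_iff[OF q1(2), of "\<epsilon> / 2" h] \<epsilon> by (simp add: \<eta>_def)
      then show ?thesis using \<epsilon> k(1) by (intro bexI[of _ k]) (auto simp: h_def)
    qed
    then show "\<exists>K. finite K \<and> (\<forall>k\<in>K. Lp_mem q k) \<and> (\<forall>x\<in>?S. \<exists>k\<in>K. Lp_norm q (k - x) < \<epsilon>)"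
      using K(1,2) S by (intro exI[of _ K]) blast
  qed
  then show ?thesis using compact_operator_Lp_iff[OF q1(1)] bounded_operator by blast
qed

end

subsection \<open>Strict singularity under change of exponents\<close>

text \<open>If R is bounded below on Z for the L_p' norm, then |z|_p' <= D |Rz|_q <= D C |z|_p, so R
  itself forces the two norms to be equivalent on Z. It remains to see that Z, closed in L_p', is
  closed in L_p as well.\<close>

lemma strictly_singular_domain_mono:
  assumes ss: "strictly_singular (Lp p) (Lp q) R" and p: "1 < p" "p \<le> p'" and q: "1 < q"
  shows "strictly_singular (Lp p') (Lp q) R"
proof -
  interpret R: Lp_operator p q R
    using ss p q by unfold_locales (simp_all add: strictly_singular_def)
  obtain C where C: "0 < C" "\<And>x. Lp_mem p x \<Longrightarrow> Lp_norm q (R x) \<le> C * Lp_norm p x"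
    using R.norm_bound by blast
  define c where "c = 2 powr (1 / p)"
  have c: "0 < c" by (simp add: c_def)
  have p1: "0 < p" "0 \<le> p" "1 \<le> p" "1 \<le> p'" "0 \<le> p'" using p by auto
  have mem: "Lp_mem p x" if "Lp_mem p' x" for x by (rule Lp_mem_mono[OF p1(2) p(2) that])
  have le: "Lp_norm p x \<le> c * Lp_norm p' x" if "Lp_mem p' x" for x
    unfolding c_def by (rule Lp_norm_mono_exponent[OF p1(1) p(2) that])
  have "Lp_norm q (R x) \<le> C * c * Lp_norm p' x" if "Lp_mem p' x" for x
  proof -
    have "C * Lp_norm p x \<le> C * (c * Lp_norm p' x)" using le[OF that] C(1) by simp
    then show ?thesis using C(2)[OF mem[OF that]] by (simp add: mult.assoc)
  qed
  then have "bounded_operator (Lp p') (Lp q) R"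
    using R.mem mem by (auto simp: bounded_operator_def Lp_def R.add R.scaleR)
  then interpret R': Lp_operator p' q R using p q by unfold_locales auto
  show ?thesis
    unfolding R'.strictly_singular_iff
  proof (intro allI impI, elim conjE exE)
    fix Z D assume Z: "subspace Z" "closedin (ntopology (Lp p')) Z"
      and D: "\<forall>z\<in>Z. Lp_norm p' z \<le> D * Lp_norm q (R z)"
    note cl = iffD1[OF closedin_Lp_iff[OF p1(4)] Z(2)]
    have Zmem: "Lp_mem p' z" if "z \<in> Z" for z using cl that by blast
    have D': "Lp_norm p' z \<le> \<bar>D\<bar> * Lp_norm q (R z)" if "z \<in> Z" for z
      by (rule order.trans[OF bspec[OF D that]]) (intro mult_right_mono, auto)
    \<comment> \<open>D is an arbitrary real, hence the absolute value; the summand 1 permits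
      division by E.\<close>
    define E where "E = \<bar>D\<bar> * C + 1"
    have E: "0 < E" using C(1) by (simp add: E_def add_nonneg_pos)
    have equiv: "Lp_norm p' z \<le> E * Lp_norm p z" if "z \<in> Z" for z
    proof -
      have "\<bar>D\<bar> * Lp_norm q (R z) \<le> \<bar>D\<bar> * (C * Lp_norm p z)"
        using C(2)[OF mem[OF Zmem[OF that]]] by (intro mult_left_mono) auto
      then have "Lp_norm p' z \<le> \<bar>D\<bar> * (C * Lp_norm p z)" using D'[OF that] by linarith
      also have "\<dots> \<le> E * Lp_norm p z" by (simp add: E_def algebra_simps)
      finally show ?thesis .
    qed
    have "closedin (ntopology (Lp p)) Z"
      unfolding closedin_Lp_iff[OF p1(3)]
    proof (intro conjI allI impI)
      show "Z \<subseteq> {f. Lp_mem p f}" using Zmem mem by blast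
      fix s :: "nat \<Rightarrow> L0" and l
      assume "range s \<subseteq> Z \<and> Lp_mem p l \<and> (\<forall>e>0. \<exists>N. \<forall>n\<ge>N. Lp_norm p (s n - l) < e)"
      then have s: "range s \<subseteq> Z" and l: "Lp_mem p l"
        and lim: "\<forall>e>0. \<exists>N. \<forall>n\<ge>N. Lp_norm p (s n - l) < e" by blast+
      have sZ: "s n \<in> Z" for n using s by blast
      have Cauchy: "\<exists>N. \<forall>i\<ge>N. \<forall>j\<ge>N. Lp_norm p' (s i - s j) < e" if e: "0 < e" for e
      proof -
        obtain N where N: "\<forall>n\<ge>N. Lp_norm p (s n - l) < e / (2 * E)"
          using lim e E by (meson divide_pos_pos mult_pos_pos zero_less_numeral)
        have "Lp_norm p' (s i - s j) < e" if ij: "i \<ge> N" "j \<ge> N" for i j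
        proof -
          have "Lp_norm p (s i - s j) \<le> Lp_norm p (s i - l) + Lp_norm p (l - s j)"
            using Lp_norm_triangle[OF p1(3) Lp_mem_diff[OF p1(2) mem[OF Zmem[OF sZ]] l, of i]
              Lp_mem_diff[OF p1(2) l mem[OF Zmem[OF sZ]], of j]] by simp
          also have "\<dots> = Lp_norm p (s i - l) + Lp_norm p (s j - l)" by (simp add: Lp_norm_commute)
          also have "\<dots> < e / (2 * E) + e / (2 * E)" using N ij by (intro add_strict_mono) auto
          finally have "E * Lp_norm p (s i - s j) < E * (e / (2 * E) + e / (2 * E))"
            using E by (rule mult_strict_left_mono)
          also have "\<dots> = e" using E by (simp add: field_simps)
          finally show ?thesis using equiv[OF subspace_diff[OF Z(1) sZ sZ], of i j] by simp
        qed
        then show ?thesis by blast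
      qed
      have s': "Lp_mem p' (s n)" for n by (rule Zmem[OF sZ])
      obtain l' where l': "Lp_mem p' l'" and lim': "\<And>e. 0 < e \<Longrightarrow> \<exists>N. \<forall>i\<ge>N. Lp_norm p' (s i - l') \<le> e"
        using Lp_complete[OF p1(4) s' Cauchy] by blast
      have "\<exists>N. \<forall>n\<ge>N. Lp_norm p' (s n - l') < e" if e: "0 < e" for e
      proof -
        obtain N where "\<forall>n\<ge>N. Lp_norm p' (s n - l') \<le> e / 2" using lim'[of "e / 2"] e by auto
        then have "\<forall>n\<ge>N. Lp_norm p' (s n - l') < e" using e by fastforce
        then show ?thesis by blast
      qed
      then have "l' \<in> Z" using cl s l' by blast
      \<comment> \<open>The sequence has the limit l in L_p and the limit l' in L_p'. Convergence in
        L_p' implies convergence in L_p, so the two coincide.\<close>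
      have "Lp_norm p (l - l') \<le> e" if e: "0 < e" for e
      proof -
        obtain N where N: "\<forall>n\<ge>N. Lp_norm p (s n - l) < e / 2" using lim e by (meson half_gt_zero)
        obtain N' where N': "\<forall>n\<ge>N'. Lp_norm p' (s n - l') \<le> e / (2 * c)"
          using lim'[of "e / (2 * c)"] e c by auto
        define n where "n = max N N'"
        have "c * Lp_norm p' (s n - l') \<le> c * (e / (2 * c))"
          using N' c by (intro mult_left_mono) (auto simp: n_def)
        also have "\<dots> = e / 2" using c by simp
        finally have "Lp_norm p (s n - l') \<le> e / 2"
          using le[OF Lp_mem_diff[OF p1(5) Zmem[OF sZ] l'], of n] by simp
        moreover have "Lp_norm p (l - s n) < e / 2" using N by (simp add: n_def Lp_norm_commute[of p l])
        moreover have "Lp_norm p (l - l') \<le> Lp_norm p (l - s n) + Lp_norm p (s n - l')"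
          using Lp_norm_triangle[OF p1(3) Lp_mem_diff[OF p1(2) l mem[OF Zmem[OF sZ]], of n]
            Lp_mem_diff[OF p1(2) mem[OF Zmem[OF sZ]] mem[OF l'], of n]] by simp
        ultimately show ?thesis by linarith
      qed
      then have "Lp_norm p (l - l') \<le> 0" by (rule field_le_epsilon[of _ 0, simplified])
      then have "Lp_norm p (l - l') = 0" using Lp_norm_nonneg[of p "l - l'"] by linarith
      then have "l = l'" using Lp_norm_eq_0[OF p1(1) Lp_mem_diff[OF p1(2) l mem[OF l']]] by simp
      then show "l \<in> Z" using \<open>l' \<in> Z\<close> by simp
    qed
    moreover have "Lp_norm p z \<le> (c * \<bar>D\<bar>) * Lp_norm q (R z)" if "z \<in> Z" for z
    proof -
      have "c * Lp_norm p' z \<le> c * (\<bar>D\<bar> * Lp_norm q (R z))"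
        using D'[OF that] c by (intro mult_left_mono) auto
      then show ?thesis using le[OF Zmem[OF that]] by (simp add: mult.assoc)
    qed
    ultimately show "\<exists>B. finite B \<and> Z \<subseteq> span B"
      using ss Z(1) unfolding R.strictly_singular_iff by blast
  qed
qed

text \<open>The domain and hence the closed subspaces stay the same, and a lower estimate against
  the weaker norm of L_q' implies one against the norm of L_q.\<close>

lemma strictly_singular_range_mono:
  assumes ss: "strictly_singular (Lp p) (Lp q) R" and p: "1 < p" and q: "1 < q'" "q' \<le> q"
  shows "strictly_singular (Lp p) (Lp q') R"
proof -
  have q1: "1 < q" "0 < q'" "0 \<le> q'" using q by auto
  interpret R: Lp_operator p q R
    using ss p q1 by unfold_locales (simp_all add: strictly_singular_def)
  obtain C where C: "0 < C" "\<And>x. Lp_mem p x \<Longrightarrow> Lp_norm q (R x) \<le> C * Lp_norm p x"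
    using R.norm_bound by blast
  define c where "c = 2 powr (1 / q')"
  have c: "0 < c" by (simp add: c_def)
  have le: "Lp_norm q' y \<le> c * Lp_norm q y" if "Lp_mem q y" for y
    unfolding c_def by (rule Lp_norm_mono_exponent[OF q1(2) q(2) that])
  have "Lp_norm q' (R x) \<le> c * C * Lp_norm p x" if "Lp_mem p x" for x
  proof -
    have "c * Lp_norm q (R x) \<le> c * (C * Lp_norm p x)" using C(2)[OF that] c by simp
    then show ?thesis using le[OF R.mem[OF that]] by (simp add: mult.assoc)
  qed
  then have "bounded_operator (Lp p) (Lp q') R"
    using Lp_mem_mono[OF q1(3) q(2) R.mem] by (auto simp: bounded_operator_def Lp_def R.add R.scaleR)
  then interpret R': Lp_operator p q' R using p q by unfold_locales auto
  show ?thesis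
    unfolding R'.strictly_singular_iff
  proof (intro allI impI, elim conjE exE)
    fix Z D assume Z: "subspace Z" "closedin (ntopology (Lp p)) Z"
      and D: "\<forall>z\<in>Z. Lp_norm p z \<le> D * Lp_norm q' (R z)"
    have Zmem: "Lp_mem p z" if "z \<in> Z" for z
      using iffD1[OF closedin_Lp_iff[OF less_imp_le[OF p]] Z(2)] that by blast
    have "Lp_norm p z \<le> (\<bar>D\<bar> * c) * Lp_norm q (R z)" if "z \<in> Z" for z
    proof -
      have "D * Lp_norm q' (R z) \<le> \<bar>D\<bar> * Lp_norm q' (R z)" by (intro mult_right_mono) auto
      also have "\<dots> \<le> \<bar>D\<bar> * (c * Lp_norm q (R z))"
        using le[OF R.mem[OF Zmem[OF that]]] by (intro mult_left_mono) auto
      finally show ?thesis using bspec[OF D that] by (simp add: mult.assoc)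
    qed
    then show "\<exists>B. finite B \<and> Z \<subseteq> span B"
      using ss Z unfolding R.strictly_singular_iff by blast
  qed
qed

section \<open>The sets S, K and V, and the conclusion\<close>

lemma mem_S_set_iff:
  "1 < p \<Longrightarrow> 1 < q \<Longrightarrow> (1 / p, 1 / q) \<in> S_set T \<longleftrightarrow> extends_to_strictly_singular T p q"
  by (auto simp: S_set_def)

lemma mem_K_set_iff:
  "1 < p \<Longrightarrow> 1 < q \<Longrightarrow> (1 / p, 1 / q) \<in> K_set T \<longleftrightarrow> extends_to_compact T p q"
  by (auto simp: K_set_def)

lemma mem_V_setE:
  assumes "(\<alpha>, \<beta>) \<in> V_set T"
  obtains p q R where "1 < p" "1 < q" "\<alpha> = 1 / p" "\<beta> = 1 / q" "strictly_singular (Lp p) (Lp q) R"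
    "\<And>f. f \<in> vecs Linf \<Longrightarrow> R f = T f" "\<not> extends_to_compact T p q"
  using assms mem_K_set_iff
  unfolding V_set_def S_set_def extends_to_strictly_singular_def by force

text \<open>Decreasing \<alpha> raises p and shrinks the domain; increasing \<beta> lowers q and
  enlarges the range. Strict singularity is inherited in these directions, while failure of
  compactness is inherited by contraposition: a compact extension at the new point would make the
  operator at the old point compact.\<close>

theorem proposition6:
  fixes T :: "L0 \<Rightarrow> L0"
  assumes "bounded_operator Linf (Lp 1) T"
  shows "(\<forall>\<alpha>\<^sub>0 \<beta>\<^sub>0. \<alpha>\<^sub>0 < \<beta>\<^sub>0 \<and> \<beta>\<^sub>0 \<le> 1/2 \<and> (\<alpha>\<^sub>0, \<beta>\<^sub>0) \<in> V_set T \<longrightarrow>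
            {(\<alpha>, \<beta>\<^sub>0) | \<alpha>. 0 < \<alpha> \<and> \<alpha> \<le> \<alpha>\<^sub>0} \<subseteq> V_set T) \<and>
         (\<forall>\<alpha>\<^sub>0 \<beta>\<^sub>0. 1/2 \<le> \<alpha>\<^sub>0 \<and> \<alpha>\<^sub>0 < \<beta>\<^sub>0 \<and> (\<alpha>\<^sub>0, \<beta>\<^sub>0) \<in> V_set T \<longrightarrow>
            {(\<alpha>\<^sub>0, \<beta>) | \<beta>. \<beta>\<^sub>0 \<le> \<beta> \<and> \<beta> < 1} \<subseteq> V_set T)"
proof (intro conjI allI impI subsetI; elim conjE)
  fix \<alpha>\<^sub>0 \<beta>\<^sub>0 :: real and z
  assume ab: "\<alpha>\<^sub>0 < \<beta>\<^sub>0" "\<beta>\<^sub>0 \<le> 1/2" and V: "(\<alpha>\<^sub>0, \<beta>\<^sub>0) \<in> V_set T"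
    and "z \<in> {(\<alpha>, \<beta>\<^sub>0) | \<alpha>. 0 < \<alpha> \<and> \<alpha> \<le> \<alpha>\<^sub>0}"
  then obtain \<alpha> where z: "z = (\<alpha>, \<beta>\<^sub>0)" and \<alpha>: "0 < \<alpha>" "\<alpha> \<le> \<alpha>\<^sub>0" by blast
  obtain p q R where pq: "1 < p" "1 < q" "\<alpha>\<^sub>0 = 1 / p" "\<beta>\<^sub>0 = 1 / q" and ss: "strictly_singular (Lp p) (Lp q) R"
    and R: "\<And>f. f \<in> vecs Linf \<Longrightarrow> R f = T f" and nc: "\<not> extends_to_compact T p q"
    using mem_V_setE[OF V] by blast
  have q: "2 \<le> q" "q < p" using ab pq by (auto simp: field_simps)
  define p' where "p' = 1 / \<alpha>"
  have p': "\<alpha> = 1 / p'" "p \<le> p'" using \<alpha> pq by (auto simp: p'_def field_simps)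
  then have "1 < p'" using pq by simp
  interpret R: Lp_operator p q R
    using ss pq by unfold_locales (simp_all add: strictly_singular_def)
  have "extends_to_strictly_singular T p' q"
    using strictly_singular_domain_mono[OF ss pq(1) p'(2) pq(2)] R
    by (auto simp: extends_to_strictly_singular_def)
  moreover have "\<not> extends_to_compact T p' q"
  proof
    assume "extends_to_compact T p' q"
    then obtain R' where R': "compact_operator (Lp p') (Lp q) R'" "\<forall>f\<in>vecs Linf. R' f = T f"
      by (auto simp: extends_to_compact_def)
    have "compact_operator (Lp p) (Lp q) R"
      by (rule R.compact_if_compact_on_Linf[OF q \<open>1 < p'\<close> R'(1)]) (simp add: R R'(2))
    then show False using nc R by (auto simp: extends_to_compact_def)
  qed
  ultimately show "z \<in> V_set T"
    using mem_S_set_iff[OF \<open>1 < p'\<close> pq(2)] mem_K_set_iff[OF \<open>1 < p'\<close> pq(2)]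
    by (simp add: V_set_def z p'(1) pq(4))
next
  fix \<alpha>\<^sub>0 \<beta>\<^sub>0 :: real and z
  assume ab: "1/2 \<le> \<alpha>\<^sub>0" "\<alpha>\<^sub>0 < \<beta>\<^sub>0" and V: "(\<alpha>\<^sub>0, \<beta>\<^sub>0) \<in> V_set T"
    and "z \<in> {(\<alpha>\<^sub>0, \<beta>) | \<beta>. \<beta>\<^sub>0 \<le> \<beta> \<and> \<beta> < 1}"
  then obtain \<beta> where z: "z = (\<alpha>\<^sub>0, \<beta>)" and \<beta>: "\<beta>\<^sub>0 \<le> \<beta>" "\<beta> < 1" by blast
  obtain p q R where pq: "1 < p" "1 < q" "\<alpha>\<^sub>0 = 1 / p" "\<beta>\<^sub>0 = 1 / q" and ss: "strictly_singular (Lp p) (Lp q) R"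
    and R: "\<And>f. f \<in> vecs Linf \<Longrightarrow> R f = T f" and nc: "\<not> extends_to_compact T p q"
    using mem_V_setE[OF V] by blast
  have p: "p \<le> 2" "q < p" using ab pq by (auto simp: field_simps)
  define q' where "q' = 1 / \<beta>"
  have "0 < \<beta>\<^sub>0" using pq by simp
  then have "0 < \<beta>" using \<beta> by simp
  then have q': "\<beta> = 1 / q'" "q' \<le> q" "1 < q'" using \<beta> pq by (auto simp: q'_def field_simps)
  interpret R: Lp_operator p q R
    using ss pq by unfold_locales (simp_all add: strictly_singular_def)
  have "extends_to_strictly_singular T p q'"
    using strictly_singular_range_mono[OF ss pq(1) q'(3,2)] R
    by (auto simp: extends_to_strictly_singular_def)
  moreover have "\<not> extends_to_compact T p q'"
  proof
    assume "extends_to_compact T p q'"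
    then obtain R' where R': "compact_operator (Lp p) (Lp q') R'" "\<forall>f\<in>vecs Linf. R' f = T f"
      by (auto simp: extends_to_compact_def)
    have "compact_operator (Lp p) (Lp q) R"
      by (rule R.compact_if_compact_to_larger_space[OF p q'(3,2) R'(1)]) (simp add: R R'(2))
    then show False using nc R by (auto simp: extends_to_compact_def)
  qed
  ultimately show "z \<in> V_set T"
    using mem_S_set_iff[OF pq(1) q'(3)] mem_K_set_iff[OF pq(1) q'(3)]
    by (simp add: V_set_def z q'(1) pq(3))
qed

end
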